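(* There is a constant $c$ such that for every infinite binary sequence $\alpha$ we have $C^{0'}(\alpha)\leqslant M_{\infty}(\alpha)+c$.
   Context: Fix an optimal programming language $U$: a computable function $(p,n)\mapsto U(p,n)$ such that for every computable $V(p,n)$ there is a constant $c$ with: for every $p$ there is $p'$ with $l(p')\leqslant l(p)+c$ and $U(p',n)=V(p,n)$ for all $n$. Write $p(n)=U(p,n)$ and $l(p)$ for the length of $p$. Conditional plain Kolmogorov complexity is $C(x|n)=\min\{l(p)\mid p(n)=x\}$. For an infinite binary sequence $\alpha$, $\alpha_{1:n}$ denotes its length-$n$ prefix. Define $M_{\infty}(\alpha)=\limsup_n C(\alpha_{1:n}|n)$, equivalently the minimal $m$ such that for all but finitely many $n$ there is $p$ with $l(p)\leqslant m$ and $p(n)=\alpha_{1:n}$ (and $\infty$ if no such $m$). For an oracle $A$, $C^A$ is defined in the same way using an optimal programming language whose programs may query the oracle $A$; $C^A(\alpha)=\min\{l(p)\mid \forall n\ p^A(n)=\alpha_{1:n}\}$ ($\infty$ if no such $p$). $0'$ denotes the halting problem. *)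

theory Defs
  imports Main "HOL-Library.Extended_Nat" "HOL-Library.Liminf_Limsup"
    "HOL-Library.Nat_Bijection"
begin

datatype recf =
    Zero
  | Succ
  | Proj nat
  | Comp recf "recf list"
  | PrimRec recf recf
  | Mu recf
  | Query

text \<open>
  \<open>run A f xs\<close> is the value on the argument tuple \<open>xs\<close> of the function described by \<open>f\<close>, with
  \<open>None\<close> for divergence, where \<open>Query\<close> computes the characteristic function of the oracle \<open>A\<close>.
  Arities are not enforced: each description yields a partial
  recursive function on tuples of every length, and \<open>Zero\<close> is the zero function of every arity.
  Minimisation requires all earlier values to be defined and nonzero, as usual.
\<close>

fun run :: "nat set \<Rightarrow> recf \<Rightarrow> nat list \<Rightarrow> nat option" where
  "run A Zero xs = Some 0"
| "run A Succ xs = (case xs of [x] \<Rightarrow> Some (Suc x) | _ \<Rightarrow> None)"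
| "run A (Proj i) xs = (if i < length xs then Some (xs ! i) else None)"
| "run A (Comp f gs) xs = Option.bind (those (map (\<lambda>g. run A g xs) gs)) (run A f)"
| "run A (PrimRec f g) xs =
     (case xs of
        [] \<Rightarrow> None
      | n # ys \<Rightarrow>
          rec_nat (run A f ys) (\<lambda>k r. Option.bind r (\<lambda>y. run A g (k # y # ys))) n)"
| "run A (Mu f) xs =
     (if \<exists>n. run A f (n # xs) = Some 0 \<and> (\<forall>m<n. \<exists>y>0. run A f (m # xs) = Some y)
      then Some (LEAST n. run A f (n # xs) = Some 0)
      else None)"
| "run A Query xs = (case xs of [x] \<Rightarrow> Some (if x \<in> A then 1 else 0) | _ \<Rightarrow> None)"

fun query_free :: "recf \<Rightarrow> bool" where
  "query_free (Comp f gs) \<longleftrightarrow> query_free f \<and> (\<forall>g\<in>set gs. query_free g)"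
| "query_free (PrimRec f g) \<longleftrightarrow> query_free f \<and> query_free g"
| "query_free (Mu f) \<longleftrightarrow> query_free f"
| "query_free Query \<longleftrightarrow> False"
| "query_free _ \<longleftrightarrow> True"

fun goedel :: "recf \<Rightarrow> nat" where
  "goedel Zero = prod_encode (0, 0)"
| "goedel Succ = prod_encode (1, 0)"
| "goedel (Proj i) = prod_encode (2, i)"
| "goedel (Comp f gs) = prod_encode (3, prod_encode (goedel f, list_encode (map goedel gs)))"
| "goedel (PrimRec f g) = prod_encode (4, prod_encode (goedel f, goedel g))"
| "goedel (Mu f) = prod_encode (5, goedel f)"
| "goedel Query = prod_encode (6, 0)"

text \<open>The oracle passed to \<open>run\<close> is immaterial for query-free descriptions.\<close>

definition halting_problem :: "nat set" where
  "halting_problem =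
     {prod_encode (goedel f, x) | f x. query_free f \<and> run {} f [x] \<noteq> None}"

text \<open>Binary strings are numbered bijectively (bijective base 2, least significant digit first).\<close>

fun str_code :: "bool list \<Rightarrow> nat" where
  "str_code [] = 0"
| "str_code (b # bs) = 2 * str_code bs + (if b then 2 else 1)"

text \<open>
  A programming language is a partial function: \<open>U p n = None\<close> means that program \<open>p\<close> does not
  terminate on input \<open>n\<close>.
\<close>

type_synonym language = "bool list \<Rightarrow> nat \<Rightarrow> bool list option"

definition computable :: "language \<Rightarrow> bool" where
  "computable V \<longleftrightarrow>
     (\<exists>f. query_free f \<and> (\<forall>p n. run {} f [str_code p, n] = map_option str_code (V p n)))"

definition computable_in :: "nat set \<Rightarrow> language \<Rightarrow> bool" where
  "computable_in A V \<longleftrightarrow>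
     (\<exists>f. \<forall>p n. run A f [str_code p, n] = map_option str_code (V p n))"

text \<open>The equation \<open>U p' n = V p n\<close> includes that both sides diverge together.\<close>

definition optimal :: "(language \<Rightarrow> bool) \<Rightarrow> language \<Rightarrow> bool" where
  "optimal \<C> U \<longleftrightarrow>
     \<C> U \<and>
     (\<forall>V. \<C> V \<longrightarrow>
        (\<exists>c. \<forall>p. \<exists>p'. length p' \<le> length p + c \<and> (\<forall>n. U p' n = V p n)))"

text \<open>Infima are taken in \<^typ>\<open>enat\<close>, so they are attained minima, or \<open>\<infinity>\<close> on the empty set.\<close>

definition cond_complexity :: "language \<Rightarrow> bool list \<Rightarrow> nat \<Rightarrow> enat" where
  "cond_complexity U x n = (INF p \<in> {p. U p n = Some x}. enat (length p))"

definition seq_prefix :: "(nat \<Rightarrow> bool) \<Rightarrow> nat \<Rightarrow> bool list" where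
  "seq_prefix \<alpha> n = map \<alpha> [0..<n]"

definition M_inf :: "language \<Rightarrow> (nat \<Rightarrow> bool) \<Rightarrow> enat" where
  "M_inf U \<alpha> = limsup (\<lambda>n. cond_complexity U (seq_prefix \<alpha> n) n)"

definition seq_complexity :: "language \<Rightarrow> (nat \<Rightarrow> bool) \<Rightarrow> enat" where
  "seq_complexity U \<alpha> = (INF p \<in> {p. \<forall>n. U p n = Some (seq_prefix \<alpha> n)}. enat (length p))"

end

theory Submission
  imports Defs
begin

text \<open>
  Let \<open>k = 2 ^ (m + 1) - 1\<close> bound the number of programs of length at most \<open>m\<close>, and let \<open>T n\<close> be
  the set of their outputs on \<open>n\<close>; the sequences with \<open>M\<^sub>\<infinity> \<le> m\<close> are those whose prefixes
  eventually lie in \<open>T n\<close>. Starting from the empty list, maintain at stage \<open>n\<close> a list of distinct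
  strings of length \<open>n\<close>, in each step extending all of them by one bit and, if possible, appending
  one new string, such that the list stays consistent: for every \<open>i\<close> the strings have extensions of
  length \<open>n + i\<close> whose prefixes can be added to \<open>T n, \<dots>, T (n + i)\<close> without any of these sets
  exceeding size \<open>k\<close>. As the \<open>T n\<close> are uniformly enumerable, inconsistency is a \<open>\<Sigma>\<^sub>1\<close> property, so
  the oracle \<open>0'\<close> can run the process. By compactness a consistent list always has a consistent
  extension. The list never has more than \<open>k\<close> elements, so it is eventually only extended and its
  entries converge to at most \<open>k\<close> sequences. Each \<open>\<alpha>\<close> with \<open>M\<^sub>\<infinity> \<alpha> \<le> m\<close> is one of them: otherwise a
  long prefix of \<open>\<alpha>\<close> could be appended at a late stage, since \<open>\<alpha>\<close> does not enlarge \<open>T n\<close> there. So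
  the position in the list, written with \<open>m + 1\<close> bits, describes \<open>\<alpha>\<close> relative to \<open>0'\<close>.
\<close>

section \<open>Recursive functions on encoded types\<close>

text \<open>Codes are injective but may miss numbers, so \<open>rec_fun\<close> below constrains a
  description only on codes of actual elements.\<close>

class enc =
  fixes encode :: "'a \<Rightarrow> nat"
  assumes encode_inject: "encode x = encode y \<Longrightarrow> x = y"

lemma encode_eq_iff [simp]: "encode (x::'a::enc) = encode y \<longleftrightarrow> x = y"
  using encode_inject by blast

instantiation nat :: enc
begin
definition encode_nat :: "nat \<Rightarrow> nat" where [simp]: "encode_nat n = n"
instance by standard simp
end

instantiation bool :: enc
begin
definition encode_bool :: "bool \<Rightarrow> nat" where [simp]: "encode_bool b = (if b then 1 else 0)"
instance by standard (simp split: if_splits)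
end

instantiation prod :: (enc, enc) enc
begin
definition encode_prod :: "'a \<times> 'b \<Rightarrow> nat" where
  [simp]: "encode_prod p = prod_encode (encode (fst p), encode (snd p))"
instance by standard (auto simp: prod_eq_iff)
end

instantiation list :: (enc) enc
begin
definition encode_list :: "'a list \<Rightarrow> nat" where
  [simp]: "encode_list xs = list_encode (map encode xs)"
instance
proof
  fix xs ys :: "'a list"
  assume "encode xs = encode ys"
  then have "map encode xs = map encode ys" by (simp add: list_encode_eq)
  then show "xs = ys" by (rule map_injective) (simp add: inj_def)
qed
end

text \<open>Splitting into 0 and successors follows \<open>list_encode\<close>, so that one lemma,
  \<open>rec_fun_case_code\<close>, yields the case distinctions on both options and lists.\<close>

instantiation option :: (enc) enc
begin
definition encode_option :: "'a option \<Rightarrow> nat" where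
  [simp]: "encode_option a = (case a of None \<Rightarrow> 0 | Some x \<Rightarrow> Suc (encode x))"
instance by standard (auto split: option.splits)
end

text \<open>The flag \<open>Q\<close> permits oracle queries; without it the oracle \<open>A\<close> is immaterial.\<close>

definition rec_fun :: "bool \<Rightarrow> nat set \<Rightarrow> ('a::enc \<Rightarrow> 'b::enc) \<Rightarrow> bool" where
  "rec_fun Q A f \<longleftrightarrow>
     (\<exists>r. (Q \<or> query_free r) \<and> (\<forall>x. run A r [encode x] = Some (encode (f x))))"

section \<open>Arithmetic and the inverses of the Cantor pairing\<close>

definition "r_add = PrimRec (Proj 0) (Comp Succ [Proj 1])"
definition "r_pred = PrimRec Zero (Proj 0)"
text \<open>The recursion is on the first argument, which reverses the order: the value on
  \<open>[n, m]\<close> is \<open>m - n\<close>.\<close>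

definition "r_sub = PrimRec (Proj 0) (Comp r_pred [Proj 1])"
definition "r_triangle = PrimRec Zero (Comp r_add [Comp Succ [Proj 0], Proj 1])"
definition "r_pair = Comp r_add [Comp r_triangle [r_add], Proj 0]"
text \<open>As the code of \<open>(m, n)\<close> is \<open>triangle (m + n) + m\<close>, the sum
  \<open>m + n\<close> is the least \<open>k\<close> for which the code lies below
  \<open>triangle (Suc k)\<close>.\<close>

definition "r_root = Mu (Comp r_sub [Comp r_triangle [Comp Succ [Proj 0]], Comp Succ [Proj 1]])"
definition "r_fst = Comp r_sub [Comp r_triangle [r_root], Proj 0]"
definition "r_snd = Comp r_sub [r_fst, r_root]"

lemma query_free_arith [simp]:
  "query_free r_add" "query_free r_pred" "query_free r_sub" "query_free r_triangle"
  "query_free r_pair" "query_free r_root" "query_free r_fst" "query_free r_snd"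
  by (auto simp: r_add_def r_pred_def r_sub_def r_triangle_def r_pair_def r_root_def r_fst_def
      r_snd_def)

lemma run_add [simp]: "run A r_add [m, n] = Some (m + n)"
proof -
  have "rec_nat (Some n) (\<lambda>k r. Option.bind r (\<lambda>y. Some (Suc y))) m = Some (m + n)"
    by (induction m) auto
  then show ?thesis by (simp add: r_add_def)
qed

lemma run_pred [simp]: "run A r_pred [n] = Some (n - 1)"
proof -
  have "rec_nat (Some 0) (\<lambda>k r. Option.bind r (\<lambda>y. Some k)) n = Some (n - 1)"
    by (induction n) auto
  then show ?thesis by (simp add: r_pred_def)
qed

lemma run_sub [simp]: "run A r_sub [n, m] = Some (m - n)"
proof -
  have "rec_nat (Some m) (\<lambda>k r. Option.bind r (\<lambda>y. Some (y - Suc 0))) n = Some (m - n)"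
    by (induction n) auto
  then show ?thesis by (simp add: r_sub_def)
qed

lemma run_triangle [simp]: "run A r_triangle [n] = Some (triangle n)"
proof -
  have "rec_nat (Some 0) (\<lambda>k r. Option.bind r (\<lambda>y. Some (Suc (k + y)))) n = Some (triangle n)"
    by (induction n) auto
  then show ?thesis by (simp add: r_triangle_def)
qed

lemma run_pair [simp]: "run A r_pair [m, n] = Some (prod_encode (m, n))"
  by (simp add: r_pair_def prod_encode_def)

lemma triangle_mono: "m \<le> n \<Longrightarrow> triangle m \<le> triangle n"
  by (induction n) (auto simp: le_Suc_eq)

lemma run_root [simp]: "run A r_root [prod_encode (m, n)] = Some (m + n)"
proof -
  have P: "Suc (prod_encode (m, n)) - triangle (Suc k) = 0 \<longleftrightarrow> m + n \<le> k" for k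
  proof
    assume *: "Suc (prod_encode (m, n)) - triangle (Suc k) = 0"
    show "m + n \<le> k"
    proof (rule ccontr)
      assume "\<not> m + n \<le> k"
      then have "triangle (Suc k) \<le> triangle (m + n)" by (intro triangle_mono) simp
      then show False using * by (simp add: prod_encode_def)
    qed
  next
    assume "m + n \<le> k"
    then have "triangle (Suc (m + n)) \<le> triangle (Suc k)" by (intro triangle_mono) simp
    then show "Suc (prod_encode (m, n)) - triangle (Suc k) = 0" by (simp add: prod_encode_def)
  qed
  have "(LEAST k. Suc (prod_encode (m, n)) - triangle (Suc k) = 0) = m + n"
    unfolding P by (rule Least_equality) auto
  moreover have "\<exists>k. Suc (prod_encode (m, n)) - triangle (Suc k) = 0 \<and>
      (\<forall>j<k. Suc (prod_encode (m, n)) - triangle (Suc j) > 0)"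
    unfolding P neq0_conv[symmetric] by (intro exI[of _ "m + n"]) auto
  ultimately show ?thesis by (simp add: r_root_def del: triangle_Suc)
qed

lemma run_fst [simp]: "run A r_fst [prod_encode (m, n)] = Some m"
proof -
  have "prod_encode (m, n) - triangle (m + n) = m" by (simp add: prod_encode_def)
  then show ?thesis by (simp add: r_fst_def)
qed

lemma run_snd [simp]: "run A r_snd [prod_encode (m, n)] = Some n"
  by (simp add: r_snd_def)

lemma rec_fun_obtain:
  assumes "rec_fun Q A f"
  obtains r where "Q \<or> query_free r" "\<And>x. run A r [encode x] = Some (encode (f x))"
  using assms by (auto simp: rec_fun_def)

lemma rec_funI:
  assumes "Q \<or> query_free r" "\<And>x. run A r [encode x] = Some (encode (f x))"
  shows "rec_fun Q A f"
  using assms by (auto simp: rec_fun_def)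

text \<open>The result types of \<open>f\<close> and \<open>g\<close> may differ: descriptions see
  codes only, so this also moves between, say, truth values and the numbers 0 and 1.\<close>

lemma rec_fun_cong:
  assumes "rec_fun Q A f" "\<And>x. encode (g x) = encode (f x)"
  shows "rec_fun Q A g"
  using assms by (simp add: rec_fun_def)

lemma rec_fun_comp:
  assumes "rec_fun Q A g" "rec_fun Q A f"
  shows "rec_fun Q A (\<lambda>x. g (f x))"
proof -
  from assms(1) obtain r where r: "Q \<or> query_free r" "\<And>x. run A r [encode x] = Some (encode (g x))"
    by (rule rec_fun_obtain) blast
  from assms(2) obtain s where s: "Q \<or> query_free s" "\<And>x. run A s [encode x] = Some (encode (f x))"
    by (rule rec_fun_obtain) blast
  show ?thesis by (rule rec_funI[of _ "Comp r [s]"]) (use r s in auto)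
qed

section \<open>Closure rules for recursive functions\<close>

named_theorems rec_intros

lemma rec_fun_const [rec_intros]: "rec_fun Q A (\<lambda>x. c)"
proof -
  define r where "r = ((\<lambda>r. Comp Succ [r]) ^^ encode c) Zero"
  have "query_free (((\<lambda>r. Comp Succ [r]) ^^ n) Zero) \<and>
    run A (((\<lambda>r. Comp Succ [r]) ^^ n) Zero) xs = Some n" for n xs
    by (induction n) auto
  then show ?thesis by (intro rec_funI[of _ r]) (auto simp: r_def)
qed

lemma rec_fun_id [rec_intros]: "rec_fun Q A (\<lambda>x. x)"
  by (rule rec_funI[of _ "Proj 0"]) auto

lemma rec_fun_fst [rec_intros]: "rec_fun Q A f \<Longrightarrow> rec_fun Q A (\<lambda>x. fst (f x))"
  by (rule rec_fun_comp) (auto intro!: rec_funI[of _ r_fst])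

lemma rec_fun_snd [rec_intros]: "rec_fun Q A f \<Longrightarrow> rec_fun Q A (\<lambda>x. snd (f x))"
  by (rule rec_fun_comp) (auto intro!: rec_funI[of _ r_snd])

lemma rec_fun_Pair [rec_intros]:
  assumes "rec_fun Q A f" "rec_fun Q A g"
  shows "rec_fun Q A (\<lambda>x. (f x, g x))"
proof -
  from assms(1) obtain r where r: "Q \<or> query_free r" "\<And>x. run A r [encode x] = Some (encode (f x))"
    by (rule rec_fun_obtain) blast
  from assms(2) obtain s where s: "Q \<or> query_free s" "\<And>x. run A s [encode x] = Some (encode (g x))"
    by (rule rec_fun_obtain) blast
  show ?thesis by (rule rec_funI[of _ "Comp r_pair [r, s]"]) (use r s in auto)
qed

lemma rec_fun_case_prod [rec_intros]:
  assumes "rec_fun Q A (\<lambda>x. F x (fst (f x)) (snd (f x)))"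
  shows "rec_fun Q A (\<lambda>x. case_prod (F x) (f x))"
  using assms by (simp add: case_prod_unfold)

lemma rec_fun_query [rec_intros]:
  assumes "rec_fun True A f"
  shows "rec_fun True A (\<lambda>x. f x \<in> A)"
  by (rule rec_fun_comp[OF _ assms]) (auto intro!: rec_funI[of _ Query])

text \<open>The step may use the ambient argument \<open>x\<close>, hence it has to be recursive in
  the nested triple of \<open>x\<close>, the counter and the previous value. All rules for operators
  with function arguments follow this pattern.\<close>

lemma rec_fun_rec_nat [rec_intros]:
  assumes "rec_fun Q A n" "rec_fun Q A i"
    and "rec_fun Q A (\<lambda>p. s (fst p) (fst (snd p)) (snd (snd p)))"
  shows "rec_fun Q A (\<lambda>x. rec_nat (i x) (s x) (n x))"
proof -
  from assms(1) obtain rn where rn: "Q \<or> query_free rn" "\<And>x. run A rn [encode x] = Some (encode (n x))"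
    by (rule rec_fun_obtain) blast
  from assms(2) obtain ri where ri: "Q \<or> query_free ri" "\<And>x. run A ri [encode x] = Some (encode (i x))"
    by (rule rec_fun_obtain) blast
  from assms(3) obtain rs where rs: "Q \<or> query_free rs"
    "\<And>p. run A rs [encode p] = Some (encode (s (fst p) (fst (snd p)) (snd (snd p))))"
    by (rule rec_fun_obtain) blast
  define g where "g = Comp rs [Comp r_pair [Proj 2, Comp r_pair [Proj 0, Proj 1]]]"
  have g: "run A g [k, encode y, encode x] = Some (encode (s x k y))" for k y x
    using rs(2)[of "(x, k, y)"] by (simp add: g_def)
  have "rec_nat (Some (encode (i x))) (\<lambda>k r. Option.bind r (\<lambda>y. run A g [k, y, encode x])) m
     = Some (encode (rec_nat (i x) (s x) m))" for m x
    by (induction m) (auto simp: g)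
  then show ?thesis
    by (intro rec_funI[of _ "Comp (PrimRec ri g) [rn, Proj 0]"])
      (use rn ri rs in \<open>auto simp: g_def\<close>)
qed

lemma rec_fun_funpow [rec_intros]:
  fixes s :: "'a::enc \<Rightarrow> 'b::enc \<Rightarrow> 'b"
  assumes "rec_fun Q A n" "rec_fun Q A i" "rec_fun Q A (\<lambda>p. s (fst p) (snd p))"
  shows "rec_fun Q A (\<lambda>x. (s x ^^ n x) (i x))"
proof -
  have "rec_fun Q A (\<lambda>p. (\<lambda>p. s (fst p) (snd p)) (fst p, snd (snd p)))"
    by (rule rec_fun_comp[OF assms(3)]) (intro rec_intros)
  then have "rec_fun Q A (\<lambda>x. rec_nat (i x) (\<lambda>_ y. s x y) (n x))"
    by (intro rec_fun_rec_nat assms) simp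
  moreover have "rec_nat y (\<lambda>_. g) m = (g ^^ m) y" for y :: 'b and g m
    by (induction m) auto
  ultimately show ?thesis by simp
qed

lemma rec_fun_Suc [rec_intros]: "rec_fun Q A f \<Longrightarrow> rec_fun Q A (\<lambda>x. Suc (f x))"
  by (rule rec_fun_comp) (auto intro!: rec_funI[of _ Succ])

lemma rec_fun_add [rec_intros]:
  assumes "rec_fun Q A f" "rec_fun Q A g"
  shows "rec_fun Q A (\<lambda>x. f x + g x :: nat)"
proof -
  have "rec_fun Q A (\<lambda>x. rec_nat (g x) (\<lambda>_ y. Suc y) (f x))" by (intro rec_intros assms)
  moreover have "rec_nat m (\<lambda>_ y. Suc y) n = n + m" for m n by (induction n) auto
  ultimately show ?thesis by simp
qed

lemma rec_fun_diff [rec_intros]: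
  assumes "rec_fun Q A f" "rec_fun Q A g"
  shows "rec_fun Q A (\<lambda>x. f x - g x :: nat)"
proof -
  have p: "rec_fun Q A (\<lambda>x. rec_nat 0 (\<lambda>y _. y) (h x))" if "rec_fun Q A h" for h :: "'c::enc \<Rightarrow> nat"
    by (intro rec_intros that)
  have "rec_nat 0 (\<lambda>y _. y) n = n - 1" for n :: nat by (cases n) auto
  then have p: "rec_fun Q A (\<lambda>x. h x - 1)" if "rec_fun Q A h" for h :: "'c::enc \<Rightarrow> nat"
    using p[OF that] by simp
  have "rec_fun Q A (\<lambda>x. rec_nat (f x) (\<lambda>_ y. y - 1) (g x))" by (intro rec_intros assms p)
  moreover have "rec_nat m (\<lambda>_ y. y - 1) n = m - n" for m n :: nat by (induction n) auto
  ultimately show ?thesis by simp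
qed

lemma rec_fun_mult [rec_intros]:
  assumes "rec_fun Q A f" "rec_fun Q A g"
  shows "rec_fun Q A (\<lambda>x. f x * g x :: nat)"
proof -
  have "rec_fun Q A (\<lambda>x. rec_nat 0 (\<lambda>_ y. y + g x) (f x))"
    by (intro rec_intros assms[THEN rec_fun_comp])
  moreover have "rec_nat 0 (\<lambda>_ y. y + m) n = n * m" for m n :: nat by (induction n) auto
  ultimately show ?thesis by simp
qed

lemma rec_fun_power [rec_intros]:
  assumes "rec_fun Q A f" "rec_fun Q A g"
  shows "rec_fun Q A (\<lambda>x. f x ^ g x :: nat)"
proof -
  have "rec_fun Q A (\<lambda>x. rec_nat 1 (\<lambda>_ y. f x * y) (g x))"
    by (intro rec_intros assms[THEN rec_fun_comp] assms)
  moreover have "rec_nat 1 (\<lambda>_ y. m * y) n = m ^ n" for m n :: nat by (induction n) auto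
  ultimately show ?thesis by simp
qed

text \<open>A conditional is a primitive recursion of zero steps or one, counted by the code of the
  truth value.\<close>

lemma rec_fun_if [rec_intros]:
  assumes "rec_fun Q A P" "rec_fun Q A f" "rec_fun Q A g"
  shows "rec_fun Q A (\<lambda>x. if P x then f x else g x)"
proof -
  have "rec_fun Q A (\<lambda>x. (if P x then 1 else 0) :: nat)" by (rule rec_fun_cong[OF assms(1)]) simp
  then have "rec_fun Q A (\<lambda>x. rec_nat (g x) (\<lambda>_ _. f x) ((if P x then 1 else 0) :: nat))"
    by (intro rec_fun_rec_nat assms rec_fun_comp[OF assms(2)] rec_intros)
  moreover have "rec_nat (g x) (\<lambda>_ _. f x) ((if P x then 1 else 0) :: nat) =
      (if P x then f x else g x)" for x
    by simp
  ultimately show ?thesis by simp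
qed

lemma rec_fun_eq_0:
  assumes "rec_fun Q A f"
  shows "rec_fun Q A (\<lambda>x. f x = (0::nat))"
proof -
  have "rec_fun Q A (\<lambda>x. 1 - f x)" by (intro rec_intros assms)
  then show ?thesis by (rule rec_fun_cong) auto
qed

lemma rec_fun_le [rec_intros]:
  assumes "rec_fun Q A f" "rec_fun Q A g"
  shows "rec_fun Q A (\<lambda>x. f x \<le> (g x :: nat))"
proof -
  have "rec_fun Q A (\<lambda>x. f x - g x = 0)" by (intro rec_intros rec_fun_eq_0 assms)
  then show ?thesis by simp
qed

lemma rec_fun_less [rec_intros]:
  assumes "rec_fun Q A f" "rec_fun Q A g"
  shows "rec_fun Q A (\<lambda>x. f x < (g x :: nat))"
proof -
  have "rec_fun Q A (\<lambda>x. Suc (f x) \<le> g x)" by (intro rec_intros assms)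
  then show ?thesis by (simp add: Suc_le_eq)
qed

lemma rec_fun_Not [rec_intros]:
  assumes "rec_fun Q A P"
  shows "rec_fun Q A (\<lambda>x. \<not> P x)"
proof -
  have "rec_fun Q A (\<lambda>x. if P x then False else True)" by (intro rec_intros assms)
  then show ?thesis by (rule rec_fun_cong) auto
qed

lemma rec_fun_conj [rec_intros]:
  assumes "rec_fun Q A P" "rec_fun Q A R"
  shows "rec_fun Q A (\<lambda>x. P x \<and> R x)"
proof -
  have "rec_fun Q A (\<lambda>x. if P x then R x else False)" by (intro rec_intros assms)
  then show ?thesis by (rule rec_fun_cong) auto
qed

lemma rec_fun_encode:
  assumes "rec_fun Q A f"
  shows "rec_fun Q A (\<lambda>x. encode (f x))"
  using assms by (rule rec_fun_cong) simp

lemma rec_fun_eq [rec_intros]: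
  assumes "rec_fun Q A f" "rec_fun Q A g"
  shows "rec_fun Q A (\<lambda>x. f x = g x)"
proof -
  have "rec_fun Q A (\<lambda>x. encode (f x) \<le> encode (g x) \<and> encode (g x) \<le> encode (f x))"
    by (intro rec_intros rec_fun_encode assms)
  then show ?thesis by (rule rec_fun_cong) (auto dest: encode_inject order_antisym)
qed

lemma rec_fun_mod [rec_intros]:
  assumes "rec_fun Q A f" "rec_fun Q A g"
  shows "rec_fun Q A (\<lambda>x. f x mod g x :: nat)"
proof -
  have "rec_fun Q A (\<lambda>x. rec_nat 0 (\<lambda>_ y. if Suc y = g x then 0 else Suc y) (f x))"
    by (intro rec_intros assms(2)[THEN rec_fun_comp] assms)
  \<comment> \<open>For modulus 0 the counter never wraps, in accordance with
    \<open>n mod 0 = n\<close>.\<close>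
  moreover have "rec_nat 0 (\<lambda>_ y. if Suc y = m then 0 else Suc y) n = n mod m" for m n :: nat
    by (induction n) (auto simp: mod_Suc)
  ultimately show ?thesis by simp
qed

text \<open>
  The recursion over the truncated code evaluates the successor branch only on codes of actual
  elements; on other numbers \<open>s\<close> need not be defined.
\<close>

lemma rec_fun_case_code:
  fixes c :: "'a::enc \<Rightarrow> nat" and F :: "'a \<Rightarrow> 'b::enc" and s :: "'a \<times> 'c::enc \<Rightarrow> 'b"
  assumes "rec_fun Q A c" "rec_fun Q A z" "rec_fun Q A s"
    and "\<And>x. c x = 0 \<and> F x = z x \<or> (\<exists>y. c x = Suc (encode y) \<and> F x = s (x, y))"
  shows "rec_fun Q A F"
proof -
  from assms(1) obtain rc where rc: "Q \<or> query_free rc" "\<And>x. run A rc [encode x] = Some (encode (c x))"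
    by (rule rec_fun_obtain) blast
  from assms(2) obtain rz where rz: "Q \<or> query_free rz" "\<And>x. run A rz [encode x] = Some (encode (z x))"
    by (rule rec_fun_obtain) blast
  from assms(3) obtain rs where rs: "Q \<or> query_free rs" "\<And>p. run A rs [encode p] = Some (encode (s p))"
    by (rule rec_fun_obtain) blast
  \<comment> \<open>The sign \<open>1 - (1 - c)\<close> of the code \<open>c\<close>: the recursion
    makes no step on code 0 and one step on any other, where \<open>g\<close> finds \<open>c\<close>
    itself as its last argument.\<close>
  define sg where "sg = Comp r_sub [Comp r_sub [rc, Comp Succ [Zero]], Comp Succ [Zero]]"
  define g where "g = Comp rs [Comp r_pair [Proj 2, Comp r_pred [Proj 3]]]"
  define r where "r = Comp (PrimRec (Comp rz [Proj 0]) g) [sg, Proj 0, rc]"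
  have "run A r [encode x] = Some (encode (F x))" for x
    using assms(4)[of x]
  proof
    assume "c x = 0 \<and> F x = z x"
    then show ?thesis by (simp add: r_def sg_def rc rz)
  next
    assume "\<exists>y. c x = Suc (encode y) \<and> F x = s (x, y)"
    then obtain y where "c x = Suc (encode y)" "F x = s (x, y)" by blast
    then show ?thesis using rs(2)[of "(x, y)"] by (simp add: r_def sg_def rc rz g_def)
  qed
  then show ?thesis
    by (intro rec_funI[of _ r]) (use rc rz rs in \<open>auto simp: r_def g_def sg_def\<close>)
qed

lemma rec_fun_case_option [rec_intros]:
  assumes "rec_fun Q A f" "rec_fun Q A z" "rec_fun Q A (\<lambda>p. s (fst p) (snd p))"
  shows "rec_fun Q A (\<lambda>x. case_option (z x) (s x) (f x))"
  by (rule rec_fun_case_code[OF rec_fun_encode[OF assms(1)] assms(2,3)]) (auto split: option.splits)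

lemma rec_fun_case_list [rec_intros]:
  assumes "rec_fun Q A f" "rec_fun Q A z"
    and "rec_fun Q A (\<lambda>p. s (fst p) (fst (snd p)) (snd (snd p)))"
  shows "rec_fun Q A (\<lambda>x. case_list (z x) (s x) (f x))"
  by (rule rec_fun_case_code[OF rec_fun_encode[OF assms(1)] assms(2,3)]) (auto split: list.splits)

lemma rec_fun_Some [rec_intros]: "rec_fun Q A f \<Longrightarrow> rec_fun Q A (\<lambda>x. Some (f x))"
  by (rule rec_fun_cong[of _ _ "\<lambda>x. Suc (encode (f x))"]) (auto intro: rec_intros rec_fun_encode)

lemma rec_fun_bind [rec_intros]:
  assumes "rec_fun Q A f" "rec_fun Q A (\<lambda>p. s (fst p) (snd p))"
  shows "rec_fun Q A (\<lambda>x. Option.bind (f x) (s x))"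
proof -
  have "rec_fun Q A (\<lambda>x. case f x of None \<Rightarrow> None | Some y \<Rightarrow> s x y)" by (intro rec_intros assms)
  then show ?thesis by (rule rec_fun_cong) (auto split: option.splits)
qed

section \<open>Operations on lists\<close>

lemma rec_fun_Cons [rec_intros]:
  assumes "rec_fun Q A f" "rec_fun Q A g"
  shows "rec_fun Q A (\<lambda>x. f x # g x)"
proof -
  have "rec_fun Q A (\<lambda>x. Suc (encode (f x, g x)))" by (intro rec_intros rec_fun_encode assms)
  then show ?thesis by (rule rec_fun_cong) auto
qed

lemma length_le_encode: "length (xs :: 'a::enc list) \<le> encode xs"
proof (induction xs)
  case (Cons x xs)
  then have "length xs \<le> prod_encode (encode x, encode xs)"
    using le_prod_encode_2 order_trans by blast
  then show ?case by simp
qed simp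

text \<open>The step acts on pairs of remaining list and accumulator. It is iterated as often as the
  code of the list says, which is at least the length; surplus steps meet the empty list and change
  nothing.\<close>

lemma rec_fun_foldl [rec_intros]:
  assumes "rec_fun Q A l" "rec_fun Q A i"
    and "rec_fun Q A (\<lambda>p. s (fst p) (fst (snd p)) (snd (snd p)))"
  shows "rec_fun Q A (\<lambda>x. foldl (s x) (i x) (l x))"
proof -
  define st where "st = (\<lambda>x p. case fst p of [] \<Rightarrow> p | y # ys \<Rightarrow> (ys, s x (snd p) y))"
  have "rec_fun Q A (\<lambda>p. (\<lambda>p. s (fst p) (fst (snd p)) (snd (snd p)))
      (fst (fst p), snd (snd (fst p)), fst (snd p)))"
    by (rule rec_fun_comp[OF assms(3)]) (intro rec_intros)
  then have "rec_fun Q A (\<lambda>p. st (fst p) (snd p))"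
    unfolding st_def by (intro rec_intros) simp
  then have *: "rec_fun Q A (\<lambda>x. snd ((st x ^^ encode (l x)) (l x, i x)))"
    by (intro rec_intros assms rec_fun_encode)
  have "(st x ^^ n) (ys, a) = ([], foldl (s x) a ys)" if "length ys \<le> n" for x n ys a
    using that
  proof (induction n arbitrary: ys a)
    case (Suc n)
    show ?case
    proof (cases ys)
      case Nil
      then have "st x (ys, a) = ([], a)" by (simp add: st_def)
      then show ?thesis using Suc.IH[of "[]" a] Nil by (simp add: funpow_swap1)
    next
      case (Cons b bs)
      then have "st x (ys, a) = (bs, s x a b)" by (simp add: st_def)
      then show ?thesis using Suc Cons by (simp add: funpow_swap1)
    qed
  qed auto
  then have "snd ((st x ^^ encode (l x)) (l x, i x)) = foldl (s x) (i x) (l x)" for x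
    by (simp add: length_le_encode del: encode_list_def)
  with * show ?thesis by simp
qed

lemma rec_fun_rev [rec_intros]:
  assumes "rec_fun Q A f"
  shows "rec_fun Q A (\<lambda>x. rev (f x))"
proof -
  have "rec_fun Q A (\<lambda>x. foldl (\<lambda>ys y. y # ys) [] (f x))" by (intro rec_intros assms)
  moreover have "foldl (\<lambda>ys y. y # ys) zs xs = rev xs @ zs" for zs xs :: "'b list"
    by (induction xs arbitrary: zs) auto
  ultimately show ?thesis by simp
qed

lemma rec_fun_foldr [rec_intros]:
  assumes "rec_fun Q A l" "rec_fun Q A i"
    and "rec_fun Q A (\<lambda>p. s (fst p) (fst (snd p)) (snd (snd p)))"
  shows "rec_fun Q A (\<lambda>x. foldr (s x) (l x) (i x))"
proof -
  have "rec_fun Q A (\<lambda>p. (\<lambda>p. s (fst p) (fst (snd p)) (snd (snd p)))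
      (fst p, snd (snd p), fst (snd p)))"
    by (rule rec_fun_comp[OF assms(3)]) (intro rec_intros)
  then have "rec_fun Q A (\<lambda>x. foldl (\<lambda>a y. s x y a) (i x) (rev (l x)))"
    by (intro rec_fun_foldl rec_intros assms) simp
  then show ?thesis by (simp add: foldr_conv_foldl)
qed

lemma rec_fun_append [rec_intros]:
  assumes "rec_fun Q A f" "rec_fun Q A g"
  shows "rec_fun Q A (\<lambda>x. f x @ g x)"
proof -
  have "rec_fun Q A (\<lambda>x. foldr (\<lambda>y ys. y # ys) (f x) (g x))" by (intro rec_intros assms)
  moreover have "foldr (\<lambda>y ys. y # ys) xs zs = xs @ zs" for zs xs :: "'b list"
    by (induction xs) auto
  ultimately show ?thesis by simp
qed

lemma rec_fun_concat [rec_intros]: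
  assumes "rec_fun Q A f"
  shows "rec_fun Q A (\<lambda>x. concat (f x))"
proof -
  have "rec_fun Q A (\<lambda>x. foldr (\<lambda>y ys. y @ ys) (f x) [])" by (intro rec_intros assms)
  moreover have "foldr (\<lambda>y ys. y @ ys) xs [] = concat xs" for xs :: "'b list list"
    by (induction xs) auto
  ultimately show ?thesis by simp
qed

lemma rec_fun_map [rec_intros]:
  assumes "rec_fun Q A l" "rec_fun Q A (\<lambda>p. f (fst p) (snd p))"
  shows "rec_fun Q A (\<lambda>x. map (f x) (l x))"
proof -
  have "rec_fun Q A (\<lambda>p. (\<lambda>p. f (fst p) (snd p)) (fst p, fst (snd p)))"
    by (rule rec_fun_comp[OF assms(2)]) (intro rec_intros)
  then have "rec_fun Q A (\<lambda>x. foldr (\<lambda>y ys. f x y # ys) (l x) [])" by (intro rec_intros assms) simp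
  moreover have "foldr (\<lambda>y ys. g y # ys) xs [] = map g xs" for g :: "'b \<Rightarrow> 'c" and xs
    by (induction xs) auto
  ultimately show ?thesis by simp
qed

lemma rec_fun_filter [rec_intros]:
  assumes "rec_fun Q A l" "rec_fun Q A (\<lambda>p. P (fst p) (snd p))"
  shows "rec_fun Q A (\<lambda>x. filter (P x) (l x))"
proof -
  have "rec_fun Q A (\<lambda>p. (\<lambda>p. P (fst p) (snd p)) (fst p, fst (snd p)))"
    by (rule rec_fun_comp[OF assms(2)]) (intro rec_intros)
  then have "rec_fun Q A (\<lambda>x. foldr (\<lambda>y ys. if P x y then y # ys else ys) (l x) [])"
    by (intro rec_intros assms) simp
  moreover have "foldr (\<lambda>y ys. if p y then y # ys else ys) xs [] = filter p xs"
    for p :: "'b \<Rightarrow> bool" and xs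
    by (induction xs) auto
  ultimately show ?thesis by simp
qed

lemma rec_fun_length [rec_intros]:
  assumes "rec_fun Q A f"
  shows "rec_fun Q A (\<lambda>x. length (f x))"
proof -
  have "rec_fun Q A (\<lambda>x. foldr (\<lambda>_ n. Suc n) (f x) 0)" by (intro rec_intros assms)
  moreover have "foldr (\<lambda>_ n. Suc n) xs 0 = length xs" for xs :: "'b list"
    by (induction xs) auto
  ultimately show ?thesis by simp
qed

lemma rec_fun_member [rec_intros]:
  assumes "rec_fun Q A f" "rec_fun Q A l"
  shows "rec_fun Q A (\<lambda>x. f x \<in> set (l x))"
proof -
  have "rec_fun Q A (\<lambda>x. foldr (\<lambda>y b. if f x = y then True else b) (l x) False)"
    by (intro rec_intros assms assms(1)[THEN rec_fun_comp])
  moreover have "foldr (\<lambda>y b. if z = y then True else b) xs False \<longleftrightarrow> z \<in> set xs" for z :: 'b and xs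
    by (induction xs) auto
  ultimately show ?thesis by simp
qed

lemma rec_fun_remdups [rec_intros]:
  assumes "rec_fun Q A f"
  shows "rec_fun Q A (\<lambda>x. remdups (f x))"
proof -
  have "rec_fun Q A (\<lambda>x. foldr (\<lambda>y ys. if y \<in> set ys then ys else y # ys) (f x) [])"
    by (intro rec_intros assms)
  moreover have "foldr (\<lambda>y ys. if y \<in> set ys then ys else y # ys) xs [] = remdups xs" for xs :: "'b list"
  proof (induction xs)
    case (Cons x xs)
    then show ?case unfolding foldr_Cons comp_apply Cons.IH by simp
  qed simp
  ultimately show ?thesis by simp
qed

lemma rec_fun_upt [rec_intros]:
  assumes "rec_fun Q A f" "rec_fun Q A g"
  shows "rec_fun Q A (\<lambda>x. [f x..<g x])"
proof -
  have "rec_fun Q A (\<lambda>x. rec_nat [] (\<lambda>k ys. if f x \<le> k then ys @ [k] else ys) (g x))"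
    by (intro rec_intros assms assms(1)[THEN rec_fun_comp])
  moreover have "rec_nat [] (\<lambda>k ys. if m \<le> k then ys @ [k] else ys) n = [m..<n]" for m n
    by (induction n) auto
  ultimately show ?thesis by simp
qed

lemma rec_fun_drop [rec_intros]:
  assumes "rec_fun Q A f" "rec_fun Q A l"
  shows "rec_fun Q A (\<lambda>x. drop (f x) (l x))"
proof -
  have "rec_fun Q A (\<lambda>x. ((\<lambda>ys. case ys of [] \<Rightarrow> [] | _ # zs \<Rightarrow> zs) ^^ f x) (l x))"
    by (intro rec_intros assms)
  moreover have "((\<lambda>ys. case ys of [] \<Rightarrow> [] | _ # zs \<Rightarrow> zs) ^^ n) ys = drop n ys" for n and ys :: "'b list"
  proof (induction n)
    case (Suc n)
    then show ?case by (cases "drop n ys") (auto simp: drop_Suc drop_tl)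
  qed simp
  ultimately show ?thesis by simp
qed

lemma rec_fun_product_lists [rec_intros]:
  assumes "rec_fun Q A f"
  shows "rec_fun Q A (\<lambda>x. product_lists (f x))"
proof -
  have "rec_fun Q A (\<lambda>x. foldr (\<lambda>ys ps. concat (map (\<lambda>y. map ((#) y) ps) ys)) (f x) [[]])"
    by (intro rec_intros assms)
  moreover have "foldr (\<lambda>ys ps. concat (map (\<lambda>y. map ((#) y) ps) ys)) xss [[]] = product_lists xss"
    for xss :: "'b list list"
    by (induction xss) auto
  ultimately show ?thesis by simp
qed

text \<open>Minimisation searches for 0, the code of \<open>False\<close>, and therefore runs on the
  negation of \<open>P\<close>.\<close>

lemma rec_fun_Least:
  fixes P :: "nat \<times> 'a::enc \<Rightarrow> bool"
  assumes "rec_fun Q A P"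
  obtains r where "Q \<or> query_free r"
    "\<And>x. run A r [encode x] = (if \<exists>n. P (n, x) then Some (LEAST n. P (n, x)) else None)"
proof -
  from rec_fun_Not[OF assms] obtain r where r: "Q \<or> query_free r"
    "\<And>p. run A r [encode p] = Some (encode (\<not> P p))"
    by (rule rec_fun_obtain) blast
  have s: "run A (Comp r [r_pair]) [n, encode x] = Some (if P (n, x) then 0 else 1)" for n x
    using r(2)[of "(n, x)"] by auto
  have L: "(\<exists>n. P (n, x) \<and> (\<forall>m<n. \<not> P (m, x))) = (\<exists>n. P (n, x))" for x
    using exists_least_iff[of "\<lambda>n. P (n, x)"] by auto
  have "run A (Comp r [r_pair]) [n, encode x] = Some 0 \<longleftrightarrow> P (n, x)"
    "(\<exists>y>0. run A (Comp r [r_pair]) [n, encode x] = Some y) \<longleftrightarrow> \<not> P (n, x)" for n x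
    unfolding s by auto
  then have "run A (Mu (Comp r [r_pair])) [encode x] =
      (if \<exists>n. P (n, x) then Some (LEAST n. P (n, x)) else None)" for x
    unfolding run.simps(6) by (simp only: L)
  then show ?thesis by (intro that[of "Mu (Comp r [r_pair])"]) (use r(1) in auto)
qed

section \<open>Evaluation with bounded search\<close>

text \<open>The bound \<open>t\<close> restricts only the range of minimisation, which makes
  evaluation of a fixed description total. Projection and search are phrased with
  \<open>drop\<close> and \<open>filter\<close> so that the closure rules apply.\<close>

fun eval_upto :: "nat \<Rightarrow> recf \<Rightarrow> nat list \<Rightarrow> nat option" where
  "eval_upto t Zero xs = Some 0"
| "eval_upto t Succ xs = (case xs of [x] \<Rightarrow> Some (Suc x) | _ \<Rightarrow> None)"
| "eval_upto t (Proj i) xs = (case drop i xs of [] \<Rightarrow> None | x # _ \<Rightarrow> Some x)"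
| "eval_upto t (Comp f gs) xs =
     Option.bind (those (map (\<lambda>g. eval_upto t g xs) gs)) (eval_upto t f)"
| "eval_upto t (PrimRec f g) xs =
     (case xs of
        [] \<Rightarrow> None
      | n # ys \<Rightarrow> rec_nat (eval_upto t f ys)
          (\<lambda>k r. Option.bind r (\<lambda>y. eval_upto t g (k # y # ys))) n)"
| "eval_upto t (Mu f) xs =
     (case filter (\<lambda>n. eval_upto t f (n # xs) = Some 0) [0..<t] of
        [] \<Rightarrow> None
      | n # _ \<Rightarrow>
          if filter (\<lambda>m. eval_upto t f (m # xs) = None) [0..<n] = [] then Some n else None)"
| "eval_upto t Query xs = None"

lemma rec_fun_eval_upto': "rec_fun Q A (\<lambda>p. eval_upto (fst p) f (snd p))"
proof (induction f)
  case (Comp f gs)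
  have 1: "rec_fun Q A (\<lambda>p. those (map (\<lambda>g. eval_upto (fst p) g (snd p)) gs))"
    using Comp(2)
  proof (induction gs)
    case (Cons g gs)
    then have g: "rec_fun Q A (\<lambda>p. eval_upto (fst p) g (snd p))"
      and gs: "rec_fun Q A (\<lambda>p. those (map (\<lambda>g. eval_upto (fst p) g (snd p)) gs))" by auto
    have "rec_fun Q A (\<lambda>p. case eval_upto (fst p) g (snd p) of None \<Rightarrow> None
        | Some y \<Rightarrow> Option.bind (those (map (\<lambda>g. eval_upto (fst p) g (snd p)) gs)) (\<lambda>ys. Some (y # ys)))"
      by (intro rec_intros g gs gs[THEN rec_fun_comp])
    then show ?case by (rule rec_fun_cong) (auto split: option.splits)
  qed (auto intro: rec_intros)
  \<comment> \<open>The induction hypothesis as a closure rule with arbitrary bound and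
    arguments.\<close>
  note f = rec_fun_comp[OF Comp(1), of "\<lambda>x. (T x, X x)" for T X, simplified]
  show ?case by (simp, intro rec_intros 1 f)
next
  case (PrimRec f g)
  note f = rec_fun_comp[OF PrimRec(1), of "\<lambda>x. (T x, X x)" for T X, simplified]
  note g = rec_fun_comp[OF PrimRec(2), of "\<lambda>x. (T x, X x)" for T X, simplified]
  show ?case by (simp, intro rec_intros f g)
next
  case (Mu f)
  note f = rec_fun_comp[OF Mu, of "\<lambda>x. (T x, X x)" for T X, simplified]
  show ?case by (simp, intro rec_intros f)
qed (simp, intro rec_intros)+

lemma rec_fun_eval_upto [rec_intros]:
  assumes "rec_fun Q A t" "rec_fun Q A xs"
  shows "rec_fun Q A (\<lambda>x. eval_upto (t x) f (xs x))"
  using rec_fun_comp[OF rec_fun_eval_upto' rec_fun_Pair[OF assms]] by simp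

lemma those_eq_Some_iff: "those as = Some ys \<longleftrightarrow> as = map Some ys"
proof (induction "as" arbitrary: ys)
  case (Cons a as)
  then show ?case by (cases ys) (auto split: option.splits)
qed auto

text \<open>In the case of minimisation the filter lists zeros in increasing order, so values before
  the first one are nonzero, and they are checked to be defined. Queries give no value, so the empty
  oracle is harmless.\<close>

lemma eval_upto_sound: "eval_upto t f xs = Some y \<Longrightarrow> run {} f xs = Some y"
proof (induction f arbitrary: xs y)
  case (Proj i)
  then show ?case by (auto split: list.splits simp: nth_via_drop) (metis drop_all leI list.discI)
next
  case (Comp f gs)
  from Comp.prems obtain ys where ys: "map (\<lambda>g. eval_upto t g xs) gs = map Some ys"
    "eval_upto t f ys = Some y" by (auto simp: Option.bind_eq_Some_conv those_eq_Some_iff)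
  have "map (\<lambda>g. run {} g xs) gs = map Some ys"
  proof (rule nth_equalityI)
    show len: "length (map (\<lambda>g. run {} g xs) gs) = length (map Some ys)"
      using ys(1)[THEN arg_cong, of length] by simp
    fix i assume "i < length (map (\<lambda>g. run {} g xs) gs)"
    then have i: "i < length gs" by simp
    then have "eval_upto t (gs ! i) xs = Some (ys ! i)"
      using ys(1)[THEN arg_cong, of "\<lambda>l. l ! i"] len by simp
    then show "map (\<lambda>g. run {} g xs) gs ! i = map Some ys ! i"
      using Comp.IH(2)[of "gs ! i"] i len by simp
  qed
  then have "those (map (\<lambda>g. run {} g xs) gs) = Some ys" by (simp add: those_eq_Some_iff)
  then show ?case using Comp.IH(1)[OF ys(2)] by simp
next
  case (PrimRec f g)
  then obtain n ys where xs: "xs = n # ys" by (cases xs) auto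
  have "rec_nat (eval_upto t f ys) (\<lambda>k r. Option.bind r (\<lambda>y. eval_upto t g (k # y # ys))) n = Some y
    \<Longrightarrow> rec_nat (run {} f ys) (\<lambda>k r. Option.bind r (\<lambda>y. run {} g (k # y # ys))) n = Some y" for y
  proof (induction n arbitrary: y)
    case 0
    then show ?case using PrimRec.IH(1) by simp
  next
    case (Suc n)
    then show ?case using PrimRec.IH(2) by (fastforce simp: Option.bind_eq_Some_conv)
  qed
  then show ?case using PrimRec.prems xs by simp
next
  case (Mu f)
  then obtain ns where ns: "filter (\<lambda>n. eval_upto t f (n # xs) = Some 0) [0..<t] = y # ns"
    and def: "filter (\<lambda>m. eval_upto t f (m # xs) = None) [0..<y] = []"
    by (auto split: list.splits if_splits)
  have "y \<in> set (filter (\<lambda>n. eval_upto t f (n # xs) = Some 0) [0..<t])" unfolding ns by simp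
  then have y: "eval_upto t f (y # xs) = Some 0" "y < t" by auto
  have "sorted_wrt (<) (y # ns)" unfolding ns[symmetric] by (intro sorted_wrt_filter) simp
  then have nz: "eval_upto t f (m # xs) \<noteq> Some 0" if "m < y" for m
  proof -
    assume s: "sorted_wrt (<) (y # ns)"
    have "m \<in> set (y # ns)" if "eval_upto t f (m # xs) = Some 0"
      unfolding ns[symmetric] using that \<open>m < y\<close> y by auto
    then show ?thesis using s \<open>m < y\<close> by fastforce
  qed
  have pos: "\<exists>z>0. run {} f (m # xs) = Some z" if "m < y" for m
  proof -
    have "eval_upto t f (m # xs) \<noteq> None" using def that by (auto simp: filter_empty_conv)
    then obtain z where "eval_upto t f (m # xs) = Some z" by blast
    then show ?thesis using nz[OF that] Mu.IH by (cases z) auto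
  qed
  have 0: "run {} f (y # xs) = Some 0" using Mu.IH y by blast
  have "(LEAST n. run {} f (n # xs) = Some 0) = y"
    by (rule Least_equality) (use 0 pos in \<open>force simp: not_less[symmetric]\<close>)+
  then show ?case using 0 pos by auto
qed (auto split: list.splits)

text \<open>A converging computation has finitely many subcomputations, whose bounds can be met
  simultaneously; for minimisation \<open>t\<close> must also exceed the result.\<close>

lemma eval_upto_complete:
  assumes "query_free f" "run {} f xs = Some y"
  shows "eventually (\<lambda>t. eval_upto t f xs = Some y) sequentially"
  using assms
proof (induction f arbitrary: xs y)
  case (Proj i)
  then show ?case by (auto split: list.splits if_splits simp: nth_via_drop)
next
  case (Comp f gs)
  from Comp.prems obtain ys where ys: "map (\<lambda>g. run {} g xs) gs = map Some ys"
    "run {} f ys = Some y" by (auto simp: Option.bind_eq_Some_conv those_eq_Some_iff)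
  have "eventually (\<lambda>t. \<forall>g\<in>set gs. eval_upto t g xs = run {} g xs) sequentially"
  proof (rule eventually_ball_finite, simp, rule ballI)
    fix g assume "g \<in> set gs"
    moreover from this obtain z where "run {} g xs = Some z" using ys(1)
      by (metis (mono_tags, lifting) image_eqI image_set imageE)
    ultimately show "eventually (\<lambda>t. eval_upto t g xs = run {} g xs) sequentially"
      using Comp.IH(2) Comp.prems(1) by simp
  qed
  moreover have "eventually (\<lambda>t. eval_upto t f ys = Some y) sequentially"
    using Comp.IH(1)[OF _ ys(2)] Comp.prems(1) by simp
  ultimately show ?case
  proof eventually_elim
    case (elim t)
    then have "map (\<lambda>g. eval_upto t g xs) gs = map Some ys" unfolding ys(1)[symmetric] by simp
    then have "those (map (\<lambda>g. eval_upto t g xs) gs) = Some ys" by (simp add: those_eq_Some_iff)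
    then show ?case using elim by simp
  qed
next
  case (PrimRec f g)
  then obtain n ys where xs: "xs = n # ys" by (cases xs) auto
  have "rec_nat (run {} f ys) (\<lambda>k r. Option.bind r (\<lambda>y. run {} g (k # y # ys))) n = Some y \<Longrightarrow>
    eventually (\<lambda>t. rec_nat (eval_upto t f ys)
      (\<lambda>k r. Option.bind r (\<lambda>y. eval_upto t g (k # y # ys))) n = Some y) sequentially" for y
  proof (induction n arbitrary: y)
    case 0
    then show ?case using PrimRec.IH(1) PrimRec.prems(1) by simp
  next
    case (Suc n)
    from Suc.prems obtain z where
      z: "rec_nat (run {} f ys) (\<lambda>k r. Option.bind r (\<lambda>y. run {} g (k # y # ys))) n = Some z"
      "run {} g (n # z # ys) = Some y" by (auto simp: Option.bind_eq_Some_conv)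
    have "eventually (\<lambda>t. eval_upto t g (n # z # ys) = Some y) sequentially"
      using PrimRec.IH(2)[OF _ z(2)] PrimRec.prems(1) by simp
    with Suc.IH[OF z(1)] show ?case by eventually_elim simp
  qed
  then show ?case using PrimRec.prems xs by simp
next
  case (Mu f)
  let ?P = "\<lambda>n. run {} f (n # xs) = Some 0 \<and> (\<forall>m<n. \<exists>y>0. run {} f (m # xs) = Some y)"
  from Mu.prems obtain n where n: "?P n" and y: "y = (LEAST n. run {} f (n # xs) = Some 0)"
    by (auto split: if_splits)
  have "(LEAST n. run {} f (n # xs) = Some 0) = n"
    by (rule Least_equality) (use n in \<open>force simp: not_less[symmetric]\<close>)+
  with y have [simp]: "n = y" by simp
  have "eventually (\<lambda>t. \<forall>m\<in>{..y}. eval_upto t f (m # xs) = run {} f (m # xs)) sequentially"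
  proof (rule eventually_ball_finite, simp, rule ballI)
    fix m assume "m \<in> {..y}"
    then have "\<exists>z. run {} f (m # xs) = Some z" using n by (cases "m = y") (auto simp: le_less)
    then show "eventually (\<lambda>t. eval_upto t f (m # xs) = run {} f (m # xs)) sequentially"
      using Mu.IH Mu.prems(1) by auto
  qed
  then show ?case using eventually_gt_at_top[of y]
  proof eventually_elim
    case (elim t)
    have "[0..<t] = [0..<y] @ y # [Suc y..<t]"
      using upt_add_eq_append[of 0 y "t - y"] upt_conv_Cons[of y t] \<open>y < t\<close> by simp
    moreover have "filter (\<lambda>n. eval_upto t f (n # xs) = Some 0) [0..<y] = []"
      using elim(1) n by (force simp: filter_empty_conv)
    moreover have "eval_upto t f (y # xs) = Some 0" using elim(1) n by simp
    moreover have "filter (\<lambda>m. eval_upto t f (m # xs) = None) [0..<y] = []"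
      using elim(1) n by (force simp: filter_empty_conv)
    ultimately show ?case by simp
  qed
qed (auto split: list.splits)

section \<open>Covering the limit paths of a thin family of levels\<close>

text \<open>
  The string of bits \<open>b\<^sub>i\<close> with \<open>i < n\<close> is represented by the number \<open>\<Sum>i<n. b\<^sub>i * 2 ^ i\<close>, so
  that the prefix of length \<open>m\<close> is the remainder modulo \<open>2 ^ m\<close>.
\<close>

definition extensions :: "nat \<Rightarrow> nat list \<Rightarrow> nat list list" where
  "extensions n E = product_lists (map (\<lambda>v. [v, v + 2 ^ n]) E)"

text \<open>Strings that are already in \<open>T n\<close> cost nothing; this is what lets a path
  through the levels join the list.\<close>

definition fits :: "(nat \<Rightarrow> nat set) \<Rightarrow> nat \<Rightarrow> nat \<Rightarrow> nat list \<Rightarrow> bool" where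
  "fits T k n E \<longleftrightarrow> card (T n \<union> set E) \<le> k"

primrec extendible :: "(nat \<Rightarrow> nat set) \<Rightarrow> nat \<Rightarrow> nat \<Rightarrow> nat \<Rightarrow> nat list \<Rightarrow> bool" where
  "extendible T k 0 n E \<longleftrightarrow> fits T k n E"
| "extendible T k (Suc i) n E \<longleftrightarrow>
     fits T k n E \<and> (\<exists>E'\<in>set (extensions n E). extendible T k i (Suc n) E')"

definition consistent :: "(nat \<Rightarrow> nat set) \<Rightarrow> nat \<Rightarrow> nat \<Rightarrow> nat list \<Rightarrow> bool" where
  "consistent T k n E \<longleftrightarrow> (\<forall>i. extendible T k i n E)"

definition enlargements :: "nat \<Rightarrow> nat list \<Rightarrow> nat list list" where
  "enlargements n E = concat (map (\<lambda>E'. map (\<lambda>v. E' @ [v]) (filter (\<lambda>v. v \<notin> set E') [0..<2 ^ Suc n]))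
     (extensions n E))"

text \<open>Enlargements come first, so a path is added as soon as this is consistent.\<close>

definition next_level :: "(nat \<Rightarrow> nat list \<Rightarrow> bool) \<Rightarrow> nat \<times> nat list \<Rightarrow> nat \<times> nat list" where
  "next_level P p = (Suc (fst p),
     case filter (P (Suc (fst p))) (enlargements (fst p) (snd p) @ extensions (fst p) (snd p)) of
       [] \<Rightarrow> []
     | E # _ \<Rightarrow> E)"

definition level :: "(nat \<Rightarrow> nat list \<Rightarrow> bool) \<Rightarrow> nat \<Rightarrow> nat list" where
  "level P n = snd ((next_level P ^^ n) (0, []))"

lemma in_extensions_iff:
  "E' \<in> set (extensions n E) \<longleftrightarrow> list_all2 (\<lambda>v' v. v' = v \<or> v' = v + 2 ^ n) E' E"
  by (auto simp: extensions_def product_lists_set list_all2_conv_all_nth)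

lemma in_enlargements_iff:
  "F \<in> set (enlargements n E) \<longleftrightarrow>
     (\<exists>E' v. F = E' @ [v] \<and> E' \<in> set (extensions n E) \<and> v \<notin> set E' \<and> v < 2 ^ Suc n)"
  by (auto simp: enlargements_def)

lemma extensions_nth_mod:
  assumes "E' \<in> set (extensions n E)" "set E \<subseteq> {..<2 ^ n}" "i < length E"
  shows "E' ! i mod 2 ^ n = E ! i"
proof -
  have "E ! i < 2 ^ n" using assms(2,3) by (meson lessThan_iff nth_mem subsetD)
  moreover have "E' ! i = E ! i \<or> E' ! i = E ! i + 2 ^ n"
    using assms by (auto simp: in_extensions_iff list_all2_conv_all_nth)
  ultimately show ?thesis by auto
qed

lemma length_extensions: "E' \<in> set (extensions n E) \<Longrightarrow> length E' = length E"
  by (auto simp: in_extensions_iff list_all2_lengthD)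

lemma extensions_props:
  assumes "E' \<in> set (extensions n E)" "set E \<subseteq> {..<2 ^ n}" "distinct E"
  shows "set E' \<subseteq> {..<2 ^ Suc n}" "distinct E'"
proof -
  have len: "length E' = length E" using assms(1) by (rule length_extensions)
  have "E' ! i < 2 ^ Suc n" if "i < length E" for i
  proof -
    have "E ! i < 2 ^ n" using assms(2) that by (meson lessThan_iff nth_mem subsetD)
    moreover have "E' ! i = E ! i \<or> E' ! i = E ! i + 2 ^ n"
      using assms(1) that by (auto simp: in_extensions_iff list_all2_conv_all_nth)
    ultimately show ?thesis by auto
  qed
  then show "set E' \<subseteq> {..<2 ^ Suc n}" using len by (auto simp: set_conv_nth)
  show "distinct E'"
    unfolding distinct_conv_nth len
  proof (intro allI impI notI)
    fix i j assume "i < length E" "j < length E" "i \<noteq> j" "E' ! i = E' ! j"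
    then show False
      using extensions_nth_mod[OF assms(1,2), of i] extensions_nth_mod[OF assms(1,2), of j] assms(3)
      by (simp add: nth_eq_iff_index_eq)
  qed
qed

section \<open>Monotonicity and compactness of consistency\<close>

lemma extendible_fits: "extendible T k i n E \<Longrightarrow> fits T k n E"
  by (cases i) auto

lemma consistent_fits: "consistent T k n E \<Longrightarrow> fits T k n E"
  unfolding consistent_def using extendible_fits by blast

lemma extendible_Suc: "extendible T k (Suc i) n E \<Longrightarrow> extendible T k i n E"
  by (induction i arbitrary: n E) auto

lemma extendible_antimono: "i \<le> j \<Longrightarrow> extendible T k j n E \<Longrightarrow> extendible T k i n E"
  by (induction j) (auto simp del: extendible.simps simp: le_Suc_eq dest: extendible_Suc)

lemma extendible_cong:
  assumes "\<And>m. n \<le> m \<Longrightarrow> m \<le> n + i \<Longrightarrow> S m = T m"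
  shows "extendible S k i n E = extendible T k i n E"
  using assms
proof (induction i arbitrary: n E)
  case (Suc i)
  have "extendible S k i (Suc n) E' = extendible T k i (Suc n) E'" for E'
    by (rule Suc.IH) (use Suc.prems in auto)
  then show ?case using Suc.prems[of n] by (simp add: fits_def)
qed (simp add: fits_def)

text \<open>Smaller levels leave more room. Hence a failure seen with partially enumerated levels is
  a failure for the full ones.\<close>

lemma extendible_mono:
  assumes "\<And>m. S m \<subseteq> T m" "\<And>m. finite (T m)" "extendible T k i n E"
  shows "extendible S k i n E"
  using assms(3)
proof (induction i arbitrary: n E)
  case 0
  have "card (S n \<union> set E) \<le> card (T n \<union> set E)" by (rule card_mono) (use assms in auto)
  with 0 show ?case by (simp add: fits_def)
next
  case (Suc i)
  have "card (S n \<union> set E) \<le> card (T n \<union> set E)" by (rule card_mono) (use assms in auto)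
  with Suc show ?case by (auto simp: fits_def)
qed

text \<open>Compactness: if each of the finitely many extensions failed at some depth, all would
  fail at the maximal one, and \<open>E\<close> would fail one level deeper.\<close>

lemma consistent_extension:
  assumes "consistent T k n E"
  shows "\<exists>E'\<in>set (extensions n E). consistent T k (Suc n) E'"
proof (rule ccontr)
  assume "\<not> ?thesis"
  then have "\<forall>E'\<in>set (extensions n E). \<exists>i. \<not> extendible T k i (Suc n) E'"
    by (auto simp: consistent_def)
  then obtain f where f: "\<And>E'. E' \<in> set (extensions n E) \<Longrightarrow> \<not> extendible T k (f E') (Suc n) E'"
    by metis
  define m where "m = Max (f ` set (extensions n E))"
  have "\<not> extendible T k m (Suc n) E'" if "E' \<in> set (extensions n E)" for E'
    using f[OF that] extendible_antimono[of "f E'" m] that by (auto simp: m_def)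
  then have "\<not> extendible T k (Suc m) n E" by simp
  then show False using assms unfolding consistent_def by blast
qed

section \<open>The growing list of paths\<close>

locale thin_levels =
  fixes T :: "nat \<Rightarrow> nat set" and k :: nat
  assumes finite_level: "finite (T n)" and card_level: "card (T n) \<le> k"
begin

abbreviation L :: "nat \<Rightarrow> nat list" where
  "L \<equiv> level (consistent T k)"

lemma level_0 [simp]: "L 0 = []"
  by (simp add: level_def)

lemma level_Suc:
  "L (Suc n) = (case filter (consistent T k (Suc n)) (enlargements n (L n) @ extensions n (L n)) of
     [] \<Rightarrow> [] | E # _ \<Rightarrow> E)"
proof -
  have "fst ((next_level (consistent T k) ^^ n) (0, [])) = n"
    by (induction n) (auto simp: next_level_def)
  then show ?thesis by (simp add: level_def next_level_def del: filter_append)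
qed

lemma consistent_Nil: "consistent T k n []"
proof -
  have "extendible T k i n []" for i
    by (induction i arbitrary: n) (auto simp: fits_def card_level extensions_def)
  then show ?thesis by (simp add: consistent_def)
qed

text \<open>Besides preserving consistency, a stage is greedy: it merely extends the list only if no
  enlargement is consistent. The contradiction in \<open>level_covers\<close> rests on this.\<close>

lemma level_step:
  assumes "consistent T k n (L n)"
  shows "consistent T k (Suc n) (L (Suc n))" (is ?C)
    and "L (Suc n) \<in> set (enlargements n (L n)) \<or>
      L (Suc n) \<in> set (extensions n (L n)) \<and>
        (\<forall>E\<in>set (enlargements n (L n)). \<not> consistent T k (Suc n) E)" (is ?D)
proof -
  let ?P = "consistent T k (Suc n)"
  \<comment> \<open>Some candidate always survives, so the default \<open>[]\<close> of
    \<open>next_level\<close> is not taken.\<close>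
  from consistent_extension[OF assms]
  have "filter ?P (extensions n (L n)) \<noteq> []" by (auto simp: filter_empty_conv)
  then obtain E Es where E: "filter ?P (enlargements n (L n) @ extensions n (L n)) = E # Es"
    by (cases "filter ?P (enlargements n (L n) @ extensions n (L n))") auto
  then have L: "L (Suc n) = E" by (simp add: level_Suc del: filter_append)
  have "E \<in> set (filter ?P (enlargements n (L n) @ extensions n (L n)))" unfolding E by simp
  then show ?C using L by auto
  show ?D
  proof (cases "filter ?P (enlargements n (L n))")
    case Nil
    then have "E \<in> set (filter ?P (extensions n (L n)))" using E by simp
    then show ?thesis using Nil L by (auto simp: filter_empty_conv)
  next
    case (Cons F Fs)
    then have "E = F" using E by simp
    then have "E \<in> set (filter ?P (enlargements n (L n)))" using Cons by simp
    then show ?thesis using L by simp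
  qed
qed

lemma level_consistent: "consistent T k n (L n)"
  by (induction n) (auto simp: consistent_Nil level_step)

lemma level_props: "set (L n) \<subseteq> {..<2 ^ n} \<and> distinct (L n)"
proof (induction n)
  case (Suc n)
  note p = extensions_props[OF _ conjunct1[OF Suc] conjunct2[OF Suc]]
  show ?case using level_step(2)[OF level_consistent, of n]
  proof
    assume "L (Suc n) \<in> set (enlargements n (L n))"
    then obtain E v where "L (Suc n) = E @ [v]" "E \<in> set (extensions n (L n))" "v \<notin> set E"
      "v < 2 ^ Suc n" by (auto simp: in_enlargements_iff)
    then show ?thesis using p[of E] by simp
  qed (use p in blast)
qed simp

lemma level_butlast:
  obtains E vs where "L (Suc n) = E @ vs" "E \<in> set (extensions n (L n))"
  using level_step(2)[OF level_consistent, of n] by (auto simp: in_enlargements_iff)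

lemma level_Suc_nth:
  assumes "i < length (L n)"
  shows "i < length (L (Suc n)) \<and> L (Suc n) ! i mod 2 ^ n = L n ! i"
proof -
  obtain E vs where E: "L (Suc n) = E @ vs" "E \<in> set (extensions n (L n))"
    by (rule level_butlast)
  have "length E = length (L n)" using E(2) by (rule length_extensions)
  then show ?thesis using E extensions_nth_mod[OF E(2)] level_props assms by (simp add: nth_append)
qed

text \<open>New strings go to the end and old ones keep their places, so a position names one
  growing path.\<close>

lemma level_nth:
  assumes "n \<le> m" "i < length (L n)"
  shows "i < length (L m) \<and> L m ! i mod 2 ^ n = L n ! i"
  using assms
proof (induction m rule: dec_induct)
  case base
  then have "L n ! i < 2 ^ n" using level_props[of n] by (meson lessThan_iff nth_mem subsetD)
  with base show ?case by simp
next
  case (step m)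
  then have "L (Suc m) ! i mod 2 ^ m mod 2 ^ n = L n ! i" "i < length (L (Suc m))"
    using level_Suc_nth[of i m] by auto
  then show ?case using step(1) by (simp add: mod_mod_cancel le_imp_power_dvd)
qed

lemma length_level_mono: "n \<le> m \<Longrightarrow> length (L n) \<le> length (L m)"
  using level_nth[of n m "length (L m)"] by linarith

lemma length_level_le: "length (L n) \<le> k"
proof -
  have "length (L n) = card (set (L n))" using level_props by (simp add: distinct_card)
  also have "\<dots> \<le> card (T n \<union> set (L n))" by (rule card_mono) (auto simp: finite_level)
  also have "\<dots> \<le> k"
    using level_consistent consistent_fits unfolding fits_def by blast
  finally show ?thesis .
qed

lemma length_level_stable: "\<exists>n0. \<forall>n\<ge>n0. length (L n) = length (L n0)"
proof -
  define j where "j = Max (range (\<lambda>n. length (L n)))"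
  have fin: "finite (range (\<lambda>n. length (L n)))"
    by (rule finite_subset[of _ "{..k}"]) (auto simp: length_level_le)
  then have "j \<in> range (\<lambda>n. length (L n))" unfolding j_def by (intro Max_in) auto
  then obtain n0 where n0: "j = length (L n0)" by blast
  have "length (L n) \<le> j" for n unfolding j_def using fin by (intro Max_ge) auto
  then have "length (L n) = length (L n0)" if "n \<ge> n0" for n
    using n0 length_level_mono[OF that] by (simp add: le_antisym)
  then show ?thesis by blast
qed

text \<open>Suppose that no position follows \<open>g\<close>. Past some level the length is
  constant and all positions have left \<open>g\<close> for good. Then \<open>g\<close> could be
  appended consistently, since it lies in the levels, and the greedy choice would have enlarged the
  list.\<close>

lemma level_covers:
  assumes g: "\<And>n. g n < 2 ^ n" "\<And>n. g (Suc n) = g n \<or> g (Suc n) = g n + 2 ^ n"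
    and gT: "\<And>n. n \<ge> n0 \<Longrightarrow> g n \<in> T n"
  shows "\<exists>i m. \<forall>n\<ge>m. i < length (L n) \<and> L n ! i = g n"
proof (rule ccontr)
  assume "\<not> ?thesis"
  then have none: "\<exists>n\<ge>m. \<not> (i < length (L n) \<and> L n ! i = g n)" for i m by blast
  obtain n1 where n1: "\<And>n. n \<ge> n1 \<Longrightarrow> length (L n) = length (L n1)"
    using length_level_stable by blast
  define j where "j = length (L n1)"
  have gmod: "g m mod 2 ^ n = g n" if "n \<le> m" for n m
    using that
  proof (induction m rule: dec_induct)
    case (step m)
    have "g (Suc m) mod 2 ^ n = g m mod 2 ^ n"
    proof -
      obtain c where "2 ^ m = 2 ^ n * (c :: nat)" using le_imp_power_dvd[OF step(1)] by (rule dvdE)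
      then show ?thesis using g(2)[of m] by auto
    qed
    also have "\<dots> = g n" by (rule step.IH)
    finally show ?case .
  next
    case base
    show ?case using g(1)[of n] by simp
  qed
  have "eventually (\<lambda>n. \<forall>i\<in>{..<j}. L n ! i \<noteq> g n) sequentially"
  proof (rule eventually_ball_finite, simp, rule ballI)
    fix i assume "i \<in> {..<j}"
    then have i: "i < length (L n)" if "n \<ge> n1" for n using n1[OF that] by (simp add: j_def)
    obtain n where n: "n \<ge> n1" "L n ! i \<noteq> g n" using none[of n1 i] i by blast
    \<comment> \<open>Both sides reduce modulo \<open>2 ^ n\<close> to their values at level
      \<open>n\<close>, so a disagreement persists.\<close>
    have "L m ! i \<noteq> g m" if "m \<ge> n" for m
      using n level_nth[OF that i] gmod[OF that] by auto
    then show "eventually (\<lambda>n. L n ! i \<noteq> g n) sequentially"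
      by (auto simp: eventually_sequentially)
  qed
  then obtain n2 where n2: "\<And>n i. n \<ge> n2 \<Longrightarrow> i < j \<Longrightarrow> L n ! i \<noteq> g n"
    by (auto simp: eventually_sequentially)
  define n3 where "n3 = max n0 (max n1 n2)"
  have len: "length (L n) = j" if "n \<ge> n3" for n
    using n1[of n] that by (simp add: n3_def j_def)
  have new: "g n \<notin> set (L n)" if "n \<ge> n3" for n
  proof
    assume "g n \<in> set (L n)"
    then obtain i where "i < length (L n)" "L n ! i = g n" unfolding in_set_conv_nth by blast
    moreover have "n \<ge> n2" using that by (simp add: n3_def)
    ultimately show False using n2[of n i] len[OF that] by simp
  qed
  have ext: "L (Suc n) \<in> set (extensions n (L n))" if "n \<ge> n3" for n
  proof -
    obtain E vs where E: "L (Suc n) = E @ vs" "E \<in> set (extensions n (L n))"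
      by (rule level_butlast)
    have "length E = j" using length_extensions[OF E(2)] len[OF that] by simp
    moreover have "length (E @ vs) = j" using len[of "Suc n"] that unfolding E(1) by simp
    ultimately have "vs = []" by simp
    then show ?thesis using E by simp
  qed
  \<comment> \<open>The later levels themselves, with the values of \<open>g\<close> appended,
    witness every depth: adding \<open>g n\<close> does not enlarge the set counted by
    \<open>fits\<close>.\<close>
  have "extendible T k i n (L n @ [g n])" if "n \<ge> n3" for i n
    using that
  proof (induction i arbitrary: n)
    have fits: "fits T k n (L n @ [g n])" if "n \<ge> n3" for n
    proof -
      have "T n \<union> set (L n @ [g n]) = T n \<union> set (L n)" using gT[of n] that by (auto simp: n3_def)
      then show ?thesis using consistent_fits[OF level_consistent[of n]] by (simp only: fits_def)
    qed
    {
      case 0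
      then show ?case using fits by simp
    next
      case (Suc i)
      have "L (Suc n) @ [g (Suc n)] \<in> set (extensions n (L n @ [g n]))"
        using ext[OF Suc.prems] g(2)[of n] by (simp add: in_extensions_iff list_all2_appendI)
      moreover have "extendible T k i (Suc n) (L (Suc n) @ [g (Suc n)])"
        using Suc.IH[of "Suc n"] Suc.prems by simp
      ultimately show ?case using fits[OF Suc.prems] unfolding extendible.simps by blast
    }
  qed
  then have "consistent T k (Suc n3) (L (Suc n3) @ [g (Suc n3)])" by (simp add: consistent_def)
  moreover have "L (Suc n3) @ [g (Suc n3)] \<in> set (enlargements n3 (L n3))"
    using ext[of n3] new[of "Suc n3"] g(1)[of "Suc n3"] by (simp add: in_enlargements_iff)
  \<comment> \<open>An enlargement would have length \<open>j + 1\<close>, but the length has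
    settled at \<open>j\<close>. So the stage merely extended the list, although a consistent
    enlargement existed.\<close>
  moreover have "L (Suc n3) \<notin> set (enlargements n3 (L n3))"
  proof
    assume "L (Suc n3) \<in> set (enlargements n3 (L n3))"
    then obtain E v where E: "L (Suc n3) = E @ [v]" "E \<in> set (extensions n3 (L n3))"
      by (auto simp: in_enlargements_iff)
    have "length E = j" using length_extensions[OF E(2)] len[of n3] by simp
    moreover have "length (E @ [v]) = j" using len[of "Suc n3"] unfolding E(1) by simp
    ultimately show False by simp
  qed
  ultimately show False using level_step(2)[OF level_consistent, of n3] by blast
qed

end

section \<open>Questions to the halting problem\<close>

lemma goedel_inject: "goedel f = goedel g \<Longrightarrow> f = g"
proof (induction f arbitrary: g)
  case (Comp f gs)
  then obtain f' gs' where g: "g = Comp f' gs'" by (cases g) auto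
  have "map goedel gs = map goedel gs'" using Comp.prems by (simp add: g list_encode_eq)
  then have "gs = gs'" using Comp.IH(2)
  proof (induction gs arbitrary: gs')
    case (Cons a as)
    then show ?case by (cases gs') auto
  qed simp
  then show ?case using Comp g by auto
next
  case (PrimRec f1 f2)
  then show ?case by (cases g) auto
next
  case (Mu f)
  then show ?case by (cases g) auto
next
  case Zero
  then show ?case by (cases g) auto
next
  case Succ
  then show ?case by (cases g) auto
next
  case (Proj i)
  then show ?case by (cases g) auto
next
  case Query
  then show ?case by (cases g) auto
qed

text \<open>The search for a witness is one fixed description \<open>r\<close> that halts on
  \<open>x\<close> exactly if there is a witness, so one query decides. Injectivity of
  \<open>goedel\<close> ensures that the query is about \<open>r\<close>.\<close>

lemma rec_fun_halting:
  fixes P :: "nat \<times> 'a::enc \<Rightarrow> bool"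
  assumes "rec_fun False {} P"
  shows "rec_fun True halting_problem (\<lambda>x. \<exists>n. P (n, x))"
proof -
  obtain r where r: "query_free r"
    "\<And>x. run {} r [encode x] = (if \<exists>n. P (n, x) then Some (LEAST n. P (n, x)) else None)"
    using rec_fun_Least[OF assms] by blast
  have "(\<exists>n. P (n, x)) \<longleftrightarrow> encode (goedel r, x) \<in> halting_problem" for x
  proof -
    have "encode (goedel r, x) \<in> halting_problem \<longleftrightarrow> run {} r [encode x] \<noteq> None"
      unfolding halting_problem_def using r(1) goedel_inject by (simp, metis)
    then show ?thesis unfolding r(2) by simp
  qed
  moreover have "rec_fun True halting_problem (\<lambda>x. encode (goedel r, x) \<in> halting_problem)"
    by (intro rec_intros rec_fun_encode)
  ultimately show ?thesis by simp
qed

text \<open>Partial functions in the style of Kleene's normal form: a single unbounded search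
  followed by a total function.\<close>

lemma rec_fun_partial:
  fixes P :: "nat \<times> 'a::enc \<Rightarrow> bool" and G :: "nat \<times> 'a \<Rightarrow> 'b::enc"
  assumes "rec_fun Q A P" "rec_fun Q A G"
  obtains r where "Q \<or> query_free r" "\<And>x. run A r [encode x] =
    (if \<exists>n. P (n, x) then Some (encode (G (LEAST n. P (n, x), x))) else None)"
proof -
  obtain r where r: "Q \<or> query_free r"
    "\<And>x. run A r [encode x] = (if \<exists>n. P (n, x) then Some (LEAST n. P (n, x)) else None)"
    by (rule rec_fun_Least[OF assms(1)]) blast
  from assms(2) obtain s where s: "Q \<or> query_free s" "\<And>p. run A s [encode p] = Some (encode (G p))"
    by (rule rec_fun_obtain) blast
  have s': "run A s [prod_encode (n, encode x)] = Some (encode (G (n, x)))" for n x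
    using s(2)[of "(n, x)"] by simp
  show ?thesis
    by (rule that[of "Comp s [Comp r_pair [r, Proj 0]]"]) (use r s s' in auto)
qed

section \<open>Deciding consistency\<close>

text \<open>
  A string of length \<open>n\<close> has code \<open>2 ^ n - 1 + v\<close>, where \<open>v\<close> is the number representing it; the
  truncated subtraction below affects only codes of shorter strings.
\<close>

definition outputs :: "recf \<Rightarrow> nat \<Rightarrow> nat \<Rightarrow> nat set" where
  "outputs f k n = {Suc y - 2 ^ n | q y. q < k \<and> run {} f [q, n] = Some y}"

definition outputs_upto :: "recf \<Rightarrow> nat \<Rightarrow> nat \<Rightarrow> nat \<Rightarrow> nat list" where
  "outputs_upto f s k n = foldr (\<lambda>q ys. case eval_upto s f [q, n] of None \<Rightarrow> ys
     | Some y \<Rightarrow> (Suc y - 2 ^ n) # ys) [0..<k] []"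

text \<open>A breadth-first form of \<open>extendible\<close>: the state holds the current length
  and all surviving lists. This turns the branching recursion into an iteration, to which the
  closure rules apply.\<close>

definition grow :: "(nat \<Rightarrow> nat set) \<Rightarrow> nat \<Rightarrow> nat \<times> nat list list \<Rightarrow> nat \<times> nat list list" where
  "grow T k p = (Suc (fst p),
     filter (fits T k (Suc (fst p))) (concat (map (extensions (fst p)) (snd p))))"

lemma set_outputs_upto:
  "set (outputs_upto f s k n) = {Suc y - 2 ^ n | q y. q < k \<and> eval_upto s f [q, n] = Some y}"
proof -
  have "set (foldr (\<lambda>q ys. case eval_upto s f [q, n] of None \<Rightarrow> ys
     | Some y \<Rightarrow> (Suc y - 2 ^ n) # ys) qs []) =
     {Suc y - 2 ^ n | q y. q \<in> set qs \<and> eval_upto s f [q, n] = Some y}" for qs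
    by (induction qs) (auto split: option.splits)
  then show ?thesis by (simp add: outputs_upto_def)
qed

lemma outputs_subset: "outputs f k n \<subseteq> (\<lambda>q. Suc (the (run {} f [q, n])) - 2 ^ n) ` {..<k}"
  unfolding outputs_def by force

lemma thin_levels_outputs: "thin_levels (outputs f k) k"
proof
  fix n
  show "finite (outputs f k n)" by (rule finite_subset[OF outputs_subset]) simp
  have "card (outputs f k n) \<le> card ((\<lambda>q. Suc (the (run {} f [q, n])) - 2 ^ n) ` {..<k})"
    by (rule card_mono[OF _ outputs_subset]) simp
  also have "\<dots> \<le> k" by (rule order_trans[OF card_image_le]) auto
  finally show "card (outputs f k n) \<le> k" .
qed

lemma outputs_upto_subset: "set (outputs_upto f s k n) \<subseteq> outputs f k n"
  using eval_upto_sound by (fastforce simp: set_outputs_upto outputs_def)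

lemma outputs_upto_eventually:
  assumes "query_free f"
  shows "eventually (\<lambda>s. set (outputs_upto f s k n) = outputs f k n) sequentially"
proof -
  have "eventually (\<lambda>s. \<forall>q\<in>{..<k}. eval_upto s f [q, n] = run {} f [q, n]) sequentially"
  proof (rule eventually_ball_finite, simp, rule ballI)
    fix q
    show "eventually (\<lambda>s. eval_upto s f [q, n] = run {} f [q, n]) sequentially"
    proof (cases "run {} f [q, n]")
      case None
      then have "eval_upto s f [q, n] = None" for s
        using eval_upto_sound[of s f "[q, n]"] by (cases "eval_upto s f [q, n]") auto
      then show ?thesis using None by simp
    next
      case (Some y)
      then show ?thesis using eval_upto_complete[OF assms Some] by simp
    qed
  qed
  then show ?thesis
  proof eventually_elim
    case (elim s)
    then have "q < k \<and> eval_upto s f [q, n] = Some y \<longleftrightarrow> q < k \<and> run {} f [q, n] = Some y" for q y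
      by auto
    then show ?case unfolding set_outputs_upto outputs_def by simp
  qed
qed

text \<open>The number \<open>s\<close> serves both as depth and as search bound. A failure at depth
  \<open>i\<close> involves finitely many levels, so some \<open>s \<ge> i\<close> enumerates them
  completely, and greater depth keeps the failure. Conversely, approximations from below can only
  make extending easier.\<close>

lemma not_consistent_iff:
  assumes "query_free f"
  shows "\<not> consistent (outputs f k) k n E \<longleftrightarrow>
    (\<exists>s. \<not> extendible (\<lambda>m. set (outputs_upto f s k m)) k s n E)"
proof
  assume "\<not> consistent (outputs f k) k n E"
  then obtain i where i: "\<not> extendible (outputs f k) k i n E" by (auto simp: consistent_def)
  have "eventually (\<lambda>s. \<forall>m\<in>{n..n+i}. set (outputs_upto f s k m) = outputs f k m) sequentially"
    by (rule eventually_ball_finite) (auto simp: outputs_upto_eventually[OF assms])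
  with eventually_ge_at_top[of i] have "eventually (\<lambda>s. i \<le> s \<and>
      (\<forall>m\<in>{n..n+i}. set (outputs_upto f s k m) = outputs f k m)) sequentially"
    by (rule eventually_conj)
  then obtain s where s: "i \<le> s" "\<forall>m\<in>{n..n+i}. set (outputs_upto f s k m) = outputs f k m"
    by (auto simp: eventually_sequentially)
  have "\<not> extendible (\<lambda>m. set (outputs_upto f s k m)) k i n E"
    using i extendible_cong[of n i "\<lambda>m. set (outputs_upto f s k m)" "outputs f k"] s(2) by simp
  then show "\<exists>s. \<not> extendible (\<lambda>m. set (outputs_upto f s k m)) k s n E"
    using extendible_antimono[OF s(1)] by blast
next
  assume "\<exists>s. \<not> extendible (\<lambda>m. set (outputs_upto f s k m)) k s n E"
  then obtain s where "\<not> extendible (\<lambda>m. set (outputs_upto f s k m)) k s n E" by blast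
  then have "\<not> extendible (outputs f k) k s n E"
    using extendible_mono[of "\<lambda>m. set (outputs_upto f s k m)" "outputs f k"]
      outputs_upto_subset thin_levels.finite_level[OF thin_levels_outputs] by blast
  then show "\<not> consistent (outputs f k) k n E" unfolding consistent_def by blast
qed

lemma grow_empty_iff:
  "snd ((grow T k ^^ i) (n, filter (fits T k n) Es)) = [] \<longleftrightarrow>
     (\<forall>E\<in>set Es. \<not> extendible T k i n E)"
proof (induction i arbitrary: n Es)
  case 0
  then show ?case by (simp add: filter_empty_conv)
next
  case (Suc i)
  have "grow T k (n, filter (fits T k n) Es) = (Suc n,
      filter (fits T k (Suc n)) (concat (map (extensions n) (filter (fits T k n) Es))))"
    by (simp add: grow_def)
  then show ?case unfolding funpow_Suc_right comp_apply using Suc.IH by auto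
qed

lemma rec_fun_extensions [rec_intros]:
  assumes "rec_fun Q A n" "rec_fun Q A E"
  shows "rec_fun Q A (\<lambda>x. extensions (n x) (E x))"
  unfolding extensions_def by (intro rec_intros assms assms(1)[THEN rec_fun_comp])

lemma rec_fun_outputs_upto [rec_intros]:
  assumes "rec_fun Q A s" "rec_fun Q A k" "rec_fun Q A n"
  shows "rec_fun Q A (\<lambda>x. outputs_upto f (s x) (k x) (n x))"
  unfolding outputs_upto_def
  by (intro rec_intros assms assms(1)[THEN rec_fun_comp] assms(3)[THEN rec_fun_comp])

lemma rec_fun_fits [rec_intros]:
  assumes "rec_fun Q A s" "rec_fun Q A k" "rec_fun Q A n" "rec_fun Q A E"
  shows "rec_fun Q A (\<lambda>x. fits (\<lambda>m. set (outputs_upto f (s x) (k x) m)) (k x) (n x) (E x))"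
proof -
  have "rec_fun Q A (\<lambda>x. length (remdups (outputs_upto f (s x) (k x) (n x) @ E x)) \<le> k x)"
    by (intro rec_intros assms)
  then show ?thesis by (simp add: fits_def length_remdups_card_conv)
qed

text \<open>The bound \<open>k\<close> is an argument, since it will be read off the program. The
  search starts from the single candidate \<open>E\<close>.\<close>

lemma rec_fun_not_consistent:
  assumes "query_free f"
  shows "rec_fun True halting_problem
    (\<lambda>(k, n, E). \<not> consistent (outputs f k) k n E)"
proof -
  have "rec_fun False {} (\<lambda>p. snd ((grow (\<lambda>m. set (outputs_upto f (fst p) (fst (snd p)) m))
      (fst (snd p)) ^^ fst p) (fst (snd (snd p)), filter (fits (\<lambda>m. set (outputs_upto f (fst p)
      (fst (snd p)) m)) (fst (snd p)) (fst (snd (snd p)))) [snd (snd (snd p))])) = [])"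
    unfolding grow_def by (intro rec_intros)
  then have "rec_fun False {} (\<lambda>(s, k, n, E).
      \<not> extendible (\<lambda>m. set (outputs_upto f s k m)) k s n E)"
    unfolding grow_empty_iff by (simp add: case_prod_unfold)
  from rec_fun_halting[OF this] show ?thesis
    by (simp add: not_consistent_iff[OF assms] case_prod_unfold)
qed

lemma rec_fun_consistent:
  assumes "query_free f"
    and "rec_fun True halting_problem k" "rec_fun True halting_problem n"
    and "rec_fun True halting_problem E"
  shows "rec_fun True halting_problem (\<lambda>x. consistent (outputs f (k x)) (k x) (n x) (E x))"
proof -
  have "rec_fun True halting_problem (\<lambda>x. \<not> (case (k x, n x, E x) of (k, n, E) \<Rightarrow>
      \<not> consistent (outputs f k) k n E))"
    by (intro rec_fun_Not rec_fun_comp[OF rec_fun_not_consistent] rec_intros assms)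
  then show ?thesis by simp
qed

lemma rec_fun_level:
  assumes f: "query_free f"
    and k: "rec_fun True halting_problem k" and n: "rec_fun True halting_problem n"
  shows "rec_fun True halting_problem (\<lambda>x. level (consistent (outputs f (k x)) (k x)) (n x))"
  unfolding level_def next_level_def enlargements_def
  by (intro rec_intros rec_fun_consistent k n f k[THEN rec_fun_comp] n[THEN rec_fun_comp])

section \<open>Codes of strings\<close>

text \<open>The digits 1 and 2 are the bits plus one, and these ones add up to
  \<open>2 ^ length p - 1\<close>.\<close>

lemma Suc_str_code: "Suc (str_code p) = horner_sum of_bool 2 p + 2 ^ length p"
  by (induction p) auto

lemma horner_sum_less: "horner_sum of_bool 2 p < (2::nat) ^ length p"
  by (induction p) auto

definition bits :: "nat \<Rightarrow> nat \<Rightarrow> bool list" where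
  "bits n v = map (bit v) [0..<n]"

lemma length_bits [simp]: "length (bits n v) = n"
  by (simp add: bits_def)

lemma Suc_str_code_bits: "Suc (str_code (bits n v)) = v mod 2 ^ n + 2 ^ n"
  by (simp add: Suc_str_code bits_def horner_sum_bit_eq_take_bit take_bit_eq_mod)

lemma str_code_less:
  assumes "length p \<le> m"
  shows "str_code p < 2 ^ Suc m - 1"
proof -
  have "Suc (str_code p) < 2 ^ Suc (length p)"
    unfolding Suc_str_code using horner_sum_less[of p] by simp
  also have "\<dots> \<le> 2 ^ Suc m" using assms by (intro power_increasing) auto
  finally show ?thesis by simp
qed

definition seq_val :: "(nat \<Rightarrow> bool) \<Rightarrow> nat \<Rightarrow> nat" where
  "seq_val \<alpha> n = horner_sum of_bool 2 (seq_prefix \<alpha> n)"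

lemma seq_val_less: "seq_val \<alpha> n < 2 ^ n"
  using horner_sum_less[of "seq_prefix \<alpha> n"] by (simp add: seq_val_def seq_prefix_def)

lemma seq_val_Suc: "seq_val \<alpha> (Suc n) = seq_val \<alpha> n \<or> seq_val \<alpha> (Suc n) = seq_val \<alpha> n + 2 ^ n"
  by (simp add: seq_val_def seq_prefix_def horner_sum_append)

lemma bits_seq_val:
  assumes "n \<le> m"
  shows "bits n (seq_val \<alpha> m) = seq_prefix \<alpha> n"
  using assms
  by (intro nth_equalityI)
    (auto simp: bits_def seq_prefix_def seq_val_def bit_horner_sum_bit_iff)

text \<open>The largest number of the form \<open>2 ^ l - 1\<close> not exceeding \<open>c\<close>,
  that is, the least code of a string as long as the one with code \<open>c\<close>. The map
  \<open>2 * k + 1\<close> runs through these numbers, and \<open>c\<close> steps suffice.\<close>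

definition len_bound :: "nat \<Rightarrow> nat" where
  "len_bound c = ((\<lambda>k. if 2 * k + 1 \<le> c then 2 * k + 1 else k) ^^ c) 0"

lemma len_bound_str_code: "len_bound (str_code p) = 2 ^ length p - 1"
proof -
  let ?s = "\<lambda>k. if 2 * k + 1 \<le> str_code p then 2 * k + 1 else k"
  have lo: "2 ^ length p \<le> Suc (str_code p)" and hi: "Suc (str_code p) < 2 ^ Suc (length p)"
    using horner_sum_less[of p] by (auto simp: Suc_str_code)
  have "(?s ^^ n) 0 = 2 ^ min n (length p) - 1" for n
  proof (induction n)
    case (Suc n)
    show ?case
    proof (cases "n < length p")
      case True
      have "2 * (2 ^ n - 1) + 1 = 2 ^ Suc n - (1::nat)"
        using one_le_power[of "2::nat" n] unfolding power_Suc by linarith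
      moreover have "(2::nat) ^ Suc n \<le> 2 ^ length p" using True by (intro power_increasing) auto
      ultimately show ?thesis using Suc True lo by simp
    next
      case False
      then show ?thesis using Suc hi by simp
    qed
  qed simp
  moreover have "length p \<le> str_code p"
    using lo less_exp[of "length p"] by linarith
  ultimately show ?thesis by (simp add: len_bound_def)
qed

lemma rec_fun_len_bound [rec_intros]:
  assumes "rec_fun Q A c"
  shows "rec_fun Q A (\<lambda>x. len_bound (c x))"
  unfolding len_bound_def by (intro rec_intros assms assms[THEN rec_fun_comp])

section \<open>The language of limit paths\<close>

text \<open>
  A program of length \<open>m + 1\<close> with code \<open>c = k + i\<close>, where \<open>k = 2 ^ (m + 1) - 1\<close>, describes the
  \<open>i\<close>-th path for the bound \<open>k\<close>. Both numbers are recovered from \<open>c\<close>, as \<open>len_bound c = k\<close>.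
\<close>

definition path_level :: "recf \<Rightarrow> nat \<Rightarrow> nat \<Rightarrow> nat list" where
  "path_level f c t = level (consistent (outputs f (len_bound c)) (len_bound c)) t"

text \<open>A stage is usable once the wanted position is occupied and its string has at least
  \<open>n\<close> bits. Any such stage gives the same prefix by \<open>level_nth\<close>.\<close>

definition path_ready :: "recf \<Rightarrow> nat \<times> nat \<times> nat \<Rightarrow> bool" where
  "path_ready f = (\<lambda>(t, c, n). n \<le> t \<and> c - len_bound c < length (path_level f c t))"

definition path_language :: "recf \<Rightarrow> language" where
  "path_language f p n = (let c = str_code p in
     if \<exists>t. path_ready f (t, c, n)
     then Some (bits n (path_level f c (LEAST t. path_ready f (t, c, n)) ! (c - len_bound c)))
     else None)"

lemma computable_path_language:
  assumes "query_free f"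
  shows "computable_in halting_problem (path_language f)"
proof -
  let ?H = halting_problem
  have lev: "rec_fun True ?H (\<lambda>x. path_level f (c x) (t x))"
    if "rec_fun True ?H c" "rec_fun True ?H t" for c t :: "nat \<times> nat \<times> nat \<Rightarrow> nat"
    unfolding path_level_def by (intro rec_fun_level rec_intros assms that)
  have P: "rec_fun True ?H (path_ready f)"
    unfolding path_ready_def case_prod_unfold by (intro rec_intros lev)
  \<comment> \<open>A total form of list access; the default 0 is not met at a ready stage. The
    other branch is the code of the string of the lowest \<open>n\<close> bits of
    \<open>v\<close>.\<close>
  define G where "G = (\<lambda>(t, c, n). case drop (c - len_bound c) (path_level f c t) of
    [] \<Rightarrow> 0 | v # _ \<Rightarrow> v mod 2 ^ n + 2 ^ n - 1)"
  have "rec_fun True ?H G"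
    unfolding G_def case_prod_unfold by (intro rec_intros lev)
  from rec_fun_partial[OF P this] obtain r where
    r: "\<And>x. run ?H r [encode x] = (if \<exists>t. path_ready f (t, x)
      then Some (encode (G (LEAST t. path_ready f (t, x), x))) else None)" by blast
  have "run ?H (Comp r [r_pair]) [str_code p, n] = map_option str_code (path_language f p n)" for p n
  proof (cases "\<exists>t. path_ready f (t, str_code p, n)")
    case True
    define t where "t = (LEAST t. path_ready f (t, str_code p, n))"
    have "path_ready f (t, str_code p, n)" unfolding t_def by (rule LeastI_ex[OF True])
    then have "str_code p - len_bound (str_code p) < length (path_level f (str_code p) t)"
      by (simp add: path_ready_def)
    then have "G (t, str_code p, n) = str_code (bits n
        (path_level f (str_code p) t ! (str_code p - len_bound (str_code p))))"
      using Suc_str_code_bits[of n "path_level f (str_code p) t ! (str_code p - len_bound (str_code p))"]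
      by (simp add: G_def Cons_nth_drop_Suc[symmetric])
    then show ?thesis
      using True r[of "(str_code p, n)"] by (simp add: path_language_def t_def Let_def)
  next
    case False
    then show ?thesis using r[of "(str_code p, n)"] by (simp add: path_language_def Let_def)
  qed
  then show ?thesis unfolding computable_in_def by blast
qed

lemma path_language_covers:
  assumes run: "\<And>p n. run {} f [str_code p, n] = map_option str_code (U p n)"
    and ev: "\<And>n. n \<ge> n0 \<Longrightarrow> \<exists>q. length q \<le> m \<and> U q n = Some (seq_prefix \<alpha> n)"
  shows "\<exists>p. length p = Suc m \<and> (\<forall>n. path_language f p n = Some (seq_prefix \<alpha> n))"
proof -
  define k :: nat where "k = 2 ^ Suc m - 1"
  interpret thin_levels "outputs f k" k by (rule thin_levels_outputs)
  have "seq_val \<alpha> n \<in> outputs f k n" if n: "n \<ge> n0" for n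
  proof -
    obtain q where q: "length q \<le> m" "U q n = Some (seq_prefix \<alpha> n)" using ev[OF n] by blast
    then have "run {} f [str_code q, n] = Some (str_code (seq_prefix \<alpha> n))" using run by simp
    moreover have "str_code q < k" unfolding k_def using q(1) by (rule str_code_less)
    moreover have "seq_val \<alpha> n = Suc (str_code (seq_prefix \<alpha> n)) - 2 ^ n"
      by (simp add: Suc_str_code seq_val_def) (simp add: seq_prefix_def)
    ultimately show ?thesis unfolding outputs_def by blast
  qed
  from level_covers[OF seq_val_less seq_val_Suc this]
  obtain i t0 where i: "\<And>t. t \<ge> t0 \<Longrightarrow> i < length (L t) \<and> L t ! i = seq_val \<alpha> t" by blast
  \<comment> \<open>Positions are below \<open>k < 2 ^ Suc m\<close>, so \<open>Suc m\<close> bits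
    can hold \<open>i\<close>.\<close>
  have "i < k" using i[of t0] length_level_le[of t0] by simp
  define p where "p = bits (Suc m) i"
  have len: "length p = Suc m" by (simp add: p_def)
  have "Suc (str_code p) = i + 2 ^ Suc m"
    using \<open>i < k\<close> unfolding p_def Suc_str_code_bits by (simp add: k_def)
  then have code: "str_code p - k = i" by (simp add: k_def)
  have lb: "len_bound (str_code p) = k" by (simp add: len_bound_str_code len k_def)
  have lev: "path_level f (str_code p) = L" by (simp add: path_level_def lb fun_eq_iff)
  have "path_language f p n = Some (seq_prefix \<alpha> n)" for n
  proof -
    have ready: "path_ready f (t, str_code p, n) \<longleftrightarrow> n \<le> t \<and> i < length (L t)" for t
      by (simp add: path_ready_def lb lev code)
    have ex: "\<exists>t. path_ready f (t, str_code p, n)"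
      using i[of "max t0 n"] by (auto simp: ready intro!: exI[of _ "max t0 n"])
    define t where "t = (LEAST t. path_ready f (t, str_code p, n))"
    have "path_ready f (t, str_code p, n)" unfolding t_def by (rule LeastI_ex[OF ex])
    then have t: "n \<le> t" "i < length (L t)" unfolding ready by auto
    \<comment> \<open>The least ready stage \<open>t\<close> may precede \<open>t0\<close>, so its
      entry is compared with a later one known to be on \<alpha>.\<close>
    have "L t ! i = seq_val \<alpha> (max t t0) mod 2 ^ t"
      using level_nth[of t "max t t0" i] t(2) i[of "max t t0"] by simp
    then have "bits n (L t ! i) = bits n (seq_val \<alpha> (max t t0))"
      using t(1) by (auto simp: bits_def bit_take_bit_iff simp flip: take_bit_eq_mod)
    then have "bits n (L t ! i) = seq_prefix \<alpha> n" using bits_seq_val[of n "max t t0"] t(1) by simp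
    then show ?thesis using ex by (simp add: path_language_def Let_def lb lev code t_def)
  qed
  then show ?thesis using len by blast
qed

text \<open>A finite bound excludes the empty set, and a nonempty infimum in \<open>enat\<close> is
  attained.\<close>

lemma cond_complexity_le:
  assumes "cond_complexity U x n \<le> enat m"
  shows "\<exists>q. length q \<le> m \<and> U q n = Some x"
proof -
  let ?A = "(\<lambda>p. enat (length p)) ` {p. U p n = Some x}"
  have "?A \<noteq> {}"
  proof
    assume "?A = {}"
    then have "cond_complexity U x n = \<infinity>" by (simp add: cond_complexity_def top_enat_def)
    then show False using assms by simp
  qed
  then have "Inf ?A \<in> ?A" by (auto simp: Inf_enat_def intro: LeastI)
  then show ?thesis using assms by (auto simp: cond_complexity_def)
qed

theorem theorem1:
  fixes U W :: language
  assumes "optimal computable U"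
    and "optimal (computable_in halting_problem) W"
  shows "\<exists>c::nat. \<forall>\<alpha> :: nat \<Rightarrow> bool. seq_complexity W \<alpha> \<le> M_inf U \<alpha> + enat c"
proof -
  obtain f where f: "query_free f"
    and run: "\<And>p n. run {} f [str_code p, n] = map_option str_code (U p n)"
    using assms(1) unfolding optimal_def computable_def by blast
  obtain c where c: "\<And>p. \<exists>p'. length p' \<le> length p + c \<and> (\<forall>n. W p' n = path_language f p n)"
    using assms(2) computable_path_language[OF f] unfolding optimal_def by blast
  \<comment> \<open>The extra 1 pays for the programs of length \<open>m + 1\<close> in
    \<open>path_language\<close>, and \<open>c\<close> for their translation into \<open>W\<close>;
    \<open>c\<close> is fixed before \<alpha> and \<open>m\<close>.\<close>
  have "seq_complexity W \<alpha> \<le> M_inf U \<alpha> + enat (Suc c)" for \<alpha>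
  proof (cases "M_inf U \<alpha>")
    case (enat m)
    \<comment> \<open>\<open>Limsup_lessD\<close> takes a strict bound; below
      \<open>enat (Suc m)\<close> means at most \<open>enat m\<close>.\<close>
    then have "M_inf U \<alpha> < enat (Suc m)" by simp
    then have "eventually (\<lambda>n. cond_complexity U (seq_prefix \<alpha> n) n < enat (Suc m)) sequentially"
      unfolding M_inf_def by (rule Limsup_lessD)
    then obtain n0 where n0: "\<And>n. n \<ge> n0 \<Longrightarrow> cond_complexity U (seq_prefix \<alpha> n) n < enat (Suc m)"
      by (auto simp: eventually_sequentially)
    have "cond_complexity U (seq_prefix \<alpha> n) n \<le> enat m" if "n \<ge> n0" for n
      using n0[OF that] by (cases "cond_complexity U (seq_prefix \<alpha> n) n") auto
    then have "\<exists>p. length p = Suc m \<and> (\<forall>n. path_language f p n = Some (seq_prefix \<alpha> n))"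
      by (intro path_language_covers[OF run] cond_complexity_le)
    then obtain p where p: "length p = Suc m" "\<And>n. path_language f p n = Some (seq_prefix \<alpha> n)"
      by blast
    obtain p' where p': "length p' \<le> length p + c" "\<And>n. W p' n = path_language f p n"
      using c by blast
    have "seq_complexity W \<alpha> \<le> enat (length p')"
      unfolding seq_complexity_def by (rule INF_lower) (simp add: p' p)
    also have "\<dots> \<le> enat (m + Suc c)" using p'(1) p(1) by simp
    finally show ?thesis by (simp add: enat)
  qed simp
  then show ?thesis by blast
qed

end
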